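(* Let a hyperelliptic curve of genus $g$ (in the canonical form described in the context) have all branch points real. Let $u\in\mathbb{R}^g$ be fixed and such that $\wp_{1,1,2i-1}(u)=0$ for $i=1,\dots,g$, that is, $u$ is a half-period. Then for all $\upsilon\in\mathbb{R}^g$ (at which they are defined) the functions $\wp_{1,2i-1}(u+\imath\upsilon)$, $i=1,\dots,g$, are real-valued, and the functions $\wp_{1,1,2i-1}(u+\imath\upsilon)$, $i=1,\dots,g$, are purely imaginary.
   Context: The curve is non-degenerate, $y^2=\Lambda(x)=x^{2g+1}+\sum_{i=0}^{2g}\lambda_{2i+2}x^{2g-i}$, with real branch points (roots of $\Lambda$) $e_1<e_2<\dots<e_{2g+1}$. Cuts are made between $e_{2k-1}$ and $e_{2k}$, $k=1,\dots,g$, and from $e_{2g+1}$ to $\infty$; $\mathfrak{a}_k$ encircles the cut $(e_{2k-1},e_{2k})$, and $\mathfrak{b}_k$ emerges from the cut $(e_{2k-1},e_{2k})$ and enters the cut $(e_{2g+1},\infty)$. Differentials (with $\lambda_0=1$): $$\mathrm{d}u_{2n-1}=\frac{x^{g-n}\mathrm{d}x}{-2y},\qquad \mathrm{d}r_{2n-1}=\frac{\mathrm{d}x}{-2y}\sum_{j=0}^{2n-2}(2n-1-j)\lambda_{2j}x^{g+n-1-j},\qquad n=1,\dots,g,$$ $\mathrm{d}u=(\mathrm{d}u_1,\mathrm{d}u_3,\dots,\mathrm{d}u_{2g-1})^t$, $\mathrm{d}r=(\mathrm{d}r_1,\mathrm{d}r_3,\dots,\mathrm{d}r_{2g-1})^t$.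 The matrices $\omega,\omega',\eta$ have columns $$\omega_k=\oint_{\mathfrak{a}_k}\mathrm{d}u=2\int_{e_{2k-1}}^{e_{2k}}\mathrm{d}u,\quad \omega'_k=\oint_{\mathfrak{b}_k}\mathrm{d}u=2\sum_{i=k}^{g}\int_{e_{2i}}^{e_{2i+1}}\mathrm{d}u,\quad \eta_k=\oint_{\mathfrak{a}_k}\mathrm{d}r=2\int_{e_{2k-1}}^{e_{2k}}\mathrm{d}r,$$ the integrals being along the real axis, with $y$ the boundary values from the upper half-plane of one fixed analytic branch of $\sqrt{\Lambda}$. Here $\omega$ is real and $\omega'$ purely imaginary; $\tau=\omega^{-1}\omega'$ is symmetric with $\operatorname{Im}\tau>0$; $\varkappa=\eta\omega^{-1}$ is symmetric. A half-period is a point $\tfrac12\omega\varepsilon+\tfrac12\omega'\varepsilon'$ with $\varepsilon,\varepsilon'\in\mathbb{Z}^g$. Theta function: $\theta(v;\tau)=\sum_{n\in\mathbb{Z}^g}\exp(\imath\pi n^t\tau n+2\imath\pi n^tv)$; with characteristic $[\varepsilon]=(\varepsilon',\varepsilon)^t$: $$\theta[\varepsilon](v;\tau)=\exp\big(\imath\pi(\varepsilon'^t/2)\tau(\varepsilon'/2)+2\imath\pi(v+\varepsilon/2)^t\varepsilon'/2\big)\,\theta(v+\varepsilon/2+\tau\varepsilon'/2;\tau).$$ The characteristic $[K]$ of the vector of Riemann constants (with these cycles and base-point infinity) has $\varepsilon'_k=1$ and $\varepsilon_k\equiv g-k+1\pmod 2$, $k=1,\dots,g$. The sigma function is $\sigma(u)=C\exp(-\tfrac12u^t\varkappa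 u)\,\theta[K](\omega^{-1}u;\omega^{-1}\omega')$ with a nonzero constant $C$, $u=(u_1,u_3,\dots,u_{2g-1})^t\in\mathbb{C}^g$, and $$\wp_{i,j}(u)=-\frac{\partial^2\log\sigma(u)}{\partial u_i\partial u_j},\qquad \wp_{i,j,k}(u)=-\frac{\partial^3\log\sigma(u)}{\partial u_i\partial u_j\partial u_k}.$$ These are meromorphic functions on $\mathbb{C}^g$, periodic with respect to the lattice generated by the columns of $\omega$ and $\omega'$. *)

theory Defs
  imports "HOL-Complex_Analysis.Complex_Analysis"
begin

text \<open>
  The genus is \<open>g = CARD('g)\<close> for an arbitrary finite linearly ordered index type
  \<open>'g\<close>; \<open>pos\<close> numbers its elements \<open>1, \<dots>, g\<close>. The component of position \<open>n\<close> of
  a vector indexed by \<open>'g\<close> is the one written \<open>u\<^bsub>2n-1\<^esub>\<close>, so that the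
  subscript \<open>1\<close> corresponds to \<open>Min UNIV\<close>.
\<close>

definition pos :: "'g::{finite,linorder} \<Rightarrow> nat" where
  "pos k = card {j. j \<le> k}"

definition curve_poly :: "(nat \<Rightarrow> complex) \<Rightarrow> nat \<Rightarrow> complex \<Rightarrow> complex" where
  "curve_poly lam g x = x ^ (2 * g + 1) + (\<Sum>i\<le>2 * g. lam (2 * i + 2) * x ^ (2 * g - i))"

definition real_curve :: "(nat \<Rightarrow> complex) \<Rightarrow> nat \<Rightarrow> (nat \<Rightarrow> real) \<Rightarrow> bool" where
  "real_curve lam g e \<longleftrightarrow>
     lam 0 = 1 \<and> strict_mono_on {1..2 * g + 1} e \<and>
     {x. curve_poly lam g x = 0} = (\<lambda>k. complex_of_real (e k)) ` {1..2 * g + 1}"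

text \<open>
  An analytic branch of \<open>sqrt \<Lambda>\<close> on the upper half-plane together with its
  boundary values on the real axis, i.e. its continuous extension to the closed half-plane.
\<close>

definition upper_branch :: "(complex \<Rightarrow> complex) \<Rightarrow> (complex \<Rightarrow> complex) \<Rightarrow> bool" where
  "upper_branch L y \<longleftrightarrow>
     y holomorphic_on {z. Im z > 0} \<and> continuous_on {z. Im z \<ge> 0} y \<and>
     (\<forall>z. Im z \<ge> 0 \<longrightarrow> (y z)\<^sup>2 = L z)"

definition du :: "(complex \<Rightarrow> complex) \<Rightarrow> complex \<Rightarrow> complex ^ 'g::{finite,linorder}" where
  "du y x = (\<chi> n. x ^ (CARD('g) - pos n) / (- 2 * y x))"

definition dr :: "(nat \<Rightarrow> complex) \<Rightarrow> (complex \<Rightarrow> complex) \<Rightarrow> complex \<Rightarrow>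
    complex ^ 'g::{finite,linorder}" where
  "dr lam y x = (\<chi> n. (\<Sum>j = 0..2 * pos n - 2.
       of_nat (2 * pos n - 1 - j) * lam (2 * j) * x ^ (CARD('g) + pos n - 1 - j)) / (- 2 * y x))"

text \<open>In the period matrices, row \<open>n\<close> belongs to the differential, column \<open>k\<close> to the cycle.\<close>

definition omega :: "(nat \<Rightarrow> real) \<Rightarrow> (complex \<Rightarrow> complex) \<Rightarrow>
    complex ^ 'g::{finite,linorder} ^ 'g::{finite,linorder}" where
  "omega e y = (\<chi> n k.
     2 * integral {e (2 * pos k - 1)..e (2 * pos k)} (\<lambda>x. du y (complex_of_real x) $ n))"

definition omega' :: "(nat \<Rightarrow> real) \<Rightarrow> (complex \<Rightarrow> complex) \<Rightarrow>
    complex ^ 'g::{finite,linorder} ^ 'g::{finite,linorder}" where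
  "omega' e y = (\<chi> n k.
     2 * (\<Sum>i = pos k..CARD('g).
       integral {e (2 * i)..e (2 * i + 1)} (\<lambda>x. du y (complex_of_real x) $ n)))"

definition eta :: "(nat \<Rightarrow> complex) \<Rightarrow> (nat \<Rightarrow> real) \<Rightarrow> (complex \<Rightarrow> complex) \<Rightarrow>
    complex ^ 'g::{finite,linorder} ^ 'g::{finite,linorder}" where
  "eta lam e y = (\<chi> n k.
     2 * integral {e (2 * pos k - 1)..e (2 * pos k)} (\<lambda>x. dr lam y (complex_of_real x) $ n))"

definition tau :: "(nat \<Rightarrow> real) \<Rightarrow> (complex \<Rightarrow> complex) \<Rightarrow>
    complex ^ 'g::{finite,linorder} ^ 'g::{finite,linorder}" where
  "tau e y = matrix_inv (omega e y) ** omega' e y"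

definition kappa :: "(nat \<Rightarrow> complex) \<Rightarrow> (nat \<Rightarrow> real) \<Rightarrow> (complex \<Rightarrow> complex) \<Rightarrow>
    complex ^ 'g::{finite,linorder} ^ 'g::{finite,linorder}" where
  "kappa lam e y = eta lam e y ** matrix_inv (omega e y)"

definition cvec :: "int ^ 'n \<Rightarrow> complex ^ 'n" where
  "cvec m = (\<chi> i. of_int (m $ i))"

text \<open>The product \<open>a\<^sup>t b\<close>, bilinear over the complex numbers (unlike \<open>inner\<close>).\<close>

definition dotp :: "complex ^ 'n \<Rightarrow> complex ^ 'n \<Rightarrow> complex" where
  "dotp a b = (\<Sum>i\<in>UNIV. a $ i * b $ i)"

definition theta :: "complex ^ 'n ^ 'n \<Rightarrow> complex ^ 'n \<Rightarrow> complex" where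
  "theta T v = (\<Sum>\<^sub>\<infinity>n\<in>UNIV.
     exp (\<i> * of_real pi * dotp (cvec n) (T *v cvec n) + 2 * \<i> * of_real pi * dotp (cvec n) v))"

definition theta_char :: "int ^ 'n \<Rightarrow> int ^ 'n \<Rightarrow> complex ^ 'n ^ 'n \<Rightarrow> complex ^ 'n \<Rightarrow> complex" where
  "theta_char eps' eps T v =
     (let a = (1 / 2) *s cvec eps'; b = (1 / 2) *s cvec eps in
       exp (\<i> * of_real pi * dotp a (T *v a) + 2 * \<i> * of_real pi * dotp (v + b) a) *
       theta T (v + b + T *v a))"

text \<open>The characteristic of the vector of Riemann constants, reduced modulo 2.\<close>

definition riemann_eps' :: "int ^ 'g::{finite,linorder}" where
  "riemann_eps' = (\<chi> k. 1)"

definition riemann_eps :: "int ^ 'g::{finite,linorder}" where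
  "riemann_eps = (\<chi> k. (int CARD('g) - int (pos k) + 1) mod 2)"

definition sigma_fun :: "(nat \<Rightarrow> complex) \<Rightarrow> (nat \<Rightarrow> real) \<Rightarrow> (complex \<Rightarrow> complex) \<Rightarrow> complex \<Rightarrow>
    complex ^ 'g::{finite,linorder} \<Rightarrow> complex" where
  "sigma_fun lam e y C u =
     C * exp (- (1 / 2) * dotp u (kappa lam e y *v u)) *
     theta_char riemann_eps' riemann_eps (tau e y) (matrix_inv (omega e y) *v u)"

definition partial :: "'n \<Rightarrow> (complex ^ 'n \<Rightarrow> complex) \<Rightarrow> complex ^ 'n \<Rightarrow> complex" where
  "partial i f u = deriv (\<lambda>t. f (u + t *s axis i 1)) 0"

text \<open>
  The first partial derivatives of \<open>log \<sigma>\<close> are \<open>(\<partial>\<^sub>i \<sigma>) / \<sigma>\<close> for every local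
  branch of the logarithm; the functions \<open>wp2\<close>, \<open>wp3\<close> are meaningful where \<open>\<sigma>\<close>
  does not vanish.
\<close>

definition dlog :: "'n \<Rightarrow> (complex ^ 'n \<Rightarrow> complex) \<Rightarrow> complex ^ 'n \<Rightarrow> complex" where
  "dlog i s u = partial i s u / s u"

definition wp2 :: "(complex ^ 'n \<Rightarrow> complex) \<Rightarrow> 'n \<Rightarrow> 'n \<Rightarrow> complex ^ 'n \<Rightarrow> complex" where
  "wp2 s i j u = - partial i (dlog j s) u"

definition wp3 :: "(complex ^ 'n \<Rightarrow> complex) \<Rightarrow> 'n \<Rightarrow> 'n \<Rightarrow> 'n \<Rightarrow> complex ^ 'n \<Rightarrow> complex" where
  "wp3 s i j k u = - partial i (partial j (dlog k s)) u"

definition half_period :: "(nat \<Rightarrow> real) \<Rightarrow> (complex \<Rightarrow> complex) \<Rightarrow>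
    complex ^ 'g::{finite,linorder} \<Rightarrow> bool" where
  "half_period e y w \<longleftrightarrow> (\<exists>eps eps'.
     w = (1 / 2) *s (omega e y *v cvec eps) + (1 / 2) *s (omega' e y *v cvec eps'))"

definition cplx :: "real ^ 'n \<Rightarrow> real ^ 'n \<Rightarrow> complex ^ 'n" where
  "cplx u v = (\<chi> i. Complex (u $ i) (v $ i))"

end

theory Submission
  imports Defs
begin

text \<open>
  Write \<open>\<sigma>\<close> as the exponential of a quadratic polynomial times
  \<open>P(w) = \<theta>(\<omega>\<^sup>-\<^sup>1 w + \<beta>; \<tau>)\<close>. Since \<open>y\<close> is real on the cuts and imaginary
  on the gaps between them, \<open>\<omega>\<close> and \<open>\<eta>\<close> are real and \<open>\<tau>\<close> is imaginary. Hence the half-period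
  \<open>u\<close>, being real, equals \<open>\<omega>\<epsilon>/2\<close>, and evenness, \<open>1\<close>-periodicity and conjugation symmetry of
  \<open>\<theta>\<close> show that the conjugate of \<open>P(2u - cnj w)\<close> is \<open>P(w)\<close>. The points \<open>u + \<i>\<upsilon>\<close> are fixed by
  \<open>w \<mapsto> 2u - cnj w\<close>; each derivative along a coordinate axis changes the sign of the symmetry,
  so even derivatives of \<open>log P\<close> are real there and odd ones imaginary.
\<close>

no_notation fps_nth (infixl "$" 75)

section \<open>Symmetries of the theta function\<close>

lemma cvec_nth [simp]: "cvec m $ i = of_int (m $ i)"
  by (simp add: cvec_def)

lemma dotp_add_right: "dotp a (b + c) = dotp a b + dotp a c"
  by (simp add: dotp_def algebra_simps sum.distrib)

lemma dotp_cvec_int: "dotp (cvec n) (cvec m) \<in> \<int>"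
  by (auto simp: dotp_def intro!: Ints_sum Ints_mult)

lemma theta_add_cvec: "theta T (v + cvec m) = theta T v"
proof -
  have "exp (\<i> * of_real pi * dotp (cvec n) (T *v cvec n) + 2 * \<i> * of_real pi * dotp (cvec n) (v + cvec m))
      = exp (\<i> * of_real pi * dotp (cvec n) (T *v cvec n) + 2 * \<i> * of_real pi * dotp (cvec n) v)"
    for n
  proof -
    obtain k where k: "dotp (cvec n) (cvec m) = of_int k"
      using dotp_cvec_int Ints_cases by metis
    have "exp (2 * \<i> * of_real pi * of_int k) = 1"
      using exp_integer_2pi[of "of_int k"] by (simp add: mult_ac)
    then show ?thesis
      by (simp add: dotp_add_right k distrib_left exp_add)
  qed
  then show ?thesis
    by (simp add: theta_def)
qed

text \<open>The substitution n -> -n leaves the quadratic exponent fixed and reverses the linear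
  one. Reindexing an \<open>infsum\<close> by a bijection is valid for divergent families
  too.\<close>

lemma theta_minus: "theta T (- v) = theta T v"
proof -
  let ?f = "\<lambda>n. exp (\<i> * of_real pi * dotp (cvec n) (T *v cvec n) + 2 * \<i> * of_real pi * dotp (cvec n) v)"
  have "bij (uminus :: int ^ 'a \<Rightarrow> int ^ 'a)"
    by (rule bij_uminus)
  then have "infsum (\<lambda>n. ?f (- n)) UNIV = infsum ?f UNIV"
    by (rule infsum_reindex_bij_betw)
  moreover have "?f (- n) = exp (\<i> * of_real pi * dotp (cvec n) (T *v cvec n) + 2 * \<i> * of_real pi * dotp (cvec n) (- v))" for n
    by (simp add: dotp_def matrix_vector_mult_def sum_negf)
  ultimately show ?thesis
    by (simp add: theta_def)
qed

definition vcnj :: "complex ^ 'n \<Rightarrow> complex ^ 'n" where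
  "vcnj v = (\<chi> i. cnj (v $ i))"

lemma vcnj_nth [simp]: "vcnj v $ i = cnj (v $ i)"
  by (simp add: vcnj_def)

text \<open>For imaginary \<open>T\<close> the quadratic exponent is real, so conjugation only sends
  v to minus its conjugate; evenness removes the sign.\<close>

lemma cnj_theta:
  assumes "\<And>i j. Re (T $ i $ j) = 0"
  shows "cnj (theta T v) = theta T (vcnj v)"
proof -
  have T: "cnj (T $ i $ j) = - T $ i $ j" for i j
    using assms[of i j] by (simp add: complex_eq_iff)
  have "cnj (theta T v) = theta T (- vcnj v)"
    unfolding theta_def infsum_cnj [symmetric]
    by (simp add: exp_cnj dotp_def matrix_vector_mult_def T sum_negf)
  then show ?thesis
    by (simp add: theta_minus)
qed

section \<open>Convergence of the theta series\<close>

definition rvec :: "int ^ 'n \<Rightarrow> real ^ 'n" where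
  "rvec m = (\<chi> i. of_int (m $ i))"

lemma rvec_nth [simp]: "rvec m $ i = of_int (m $ i)"
  by (simp add: rvec_def)

lemma rvec_diff: "rvec (n - k) = rvec n - rvec k"
  by (simp add: vec_eq_iff)

definition l1norm :: "real ^ 'n \<Rightarrow> real" where
  "l1norm x = (\<Sum>i\<in>UNIV. \<bar>x $ i\<bar>)"

lemma l1norm_nonneg: "l1norm x \<ge> 0"
  by (simp add: l1norm_def sum_nonneg)

text \<open>For a general matrix the two cross terms combine into one bilinear form in the
  symmetrization of \<open>M\<close>, the matrix on which the convergence argument rests.\<close>

lemma quadratic_form_add:
  fixes M :: "real ^ 'n ^ 'n"
  shows "(x + z) \<bullet> (M *v (x + z)) =
    x \<bullet> (M *v x) + x \<bullet> ((M + transpose M) *v z) + z \<bullet> (M *v z)"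
  by (simp add: inner_add_left inner_add_right matrix_vector_right_distrib
      matrix_vector_mult_add_rdistrib dot_lmul_matrix inner_commute[of z "M *v x"])
     (metis dot_lmul_matrix inner_commute transpose_matrix_vector)

lemma summable_on_finite_sum:
  fixes f :: "'b \<Rightarrow> 'a \<Rightarrow> real"
  assumes "\<And>i. i \<in> I \<Longrightarrow> f i summable_on A"
  shows "(\<lambda>x. \<Sum>i\<in>I. f i x) summable_on A"
  using assms by (induction I rule: infinite_finite_induct) (auto intro: summable_on_add)

text \<open>Markov's inequality for counting: a finite set of such points has at most (total sum) /
  c elements.\<close>

lemma finite_summable_ge:
  fixes f :: "'a \<Rightarrow> real"
  assumes "f summable_on UNIV" "\<And>x. f x \<ge> 0" "c > 0"
  shows "finite {x. f x \<ge> c}"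
proof -
  have "card G \<le> nat \<lfloor>infsum f UNIV / c\<rfloor>" if G: "G \<subseteq> {x. f x \<ge> c}" "finite G" for G
  proof -
    have "c * real (card G) \<le> sum f G"
      using sum_mono[of G "\<lambda>_. c" f] G by (auto simp: mult.commute)
    also have "\<dots> \<le> infsum f UNIV"
      using assms(1,2) G by (intro finite_sum_le_infsum) auto
    finally have "real (card G) \<le> infsum f UNIV / c"
      using \<open>c > 0\<close> by (simp add: field_simps)
    then show ?thesis by linarith
  qed
  then show ?thesis
    using finite_if_finite_subsets_card_bdd by blast
qed

lemma quadratic_form_abs_le:
  fixes M :: "real ^ 'n ^ 'n"
  assumes "\<And>i. \<bar>d $ i\<bar> \<le> 1"
  shows "\<bar>d \<bullet> (M *v d)\<bar> \<le> (\<Sum>i\<in>UNIV. \<Sum>j\<in>UNIV. \<bar>M $ i $ j\<bar>)"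
proof -
  have "\<bar>d $ i * (M $ i $ j * d $ j)\<bar> \<le> \<bar>M $ i $ j\<bar>" for i j
  proof -
    have "\<bar>d $ i\<bar> * \<bar>d $ j\<bar> \<le> 1"
      using assms by (simp add: mult_le_one)
    then have "\<bar>M $ i $ j\<bar> * (\<bar>d $ i\<bar> * \<bar>d $ j\<bar>) \<le> \<bar>M $ i $ j\<bar> * 1"
      by (intro mult_left_mono) auto
    then show ?thesis by (simp add: abs_mult mult_ac)
  qed
  then show ?thesis
    unfolding inner_vec_def matrix_vector_mult_def
    by (auto simp: sum_distrib_left intro!: order_trans[OF sum_abs] sum_mono)
qed

text \<open>A kernel vector of the symmetrized form is approximated by integer vectors on which
  the form stays bounded, which contradicts convergence.\<close>

lemma gauss_sum_symmetrized_inj: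
  fixes M :: "real ^ 'n ^ 'n"
  assumes sm: "(\<lambda>n. exp (- pi * (rvec n \<bullet> (M *v rvec n)))) summable_on UNIV"
    and ker: "(M + transpose M) *v x = 0"
  shows "x = 0"
proof (rule ccontr)
  assume "x \<noteq> 0"
  then obtain i where i: "x $ i \<noteq> 0"
    by (auto simp: vec_eq_iff)
  define K where "K = (\<Sum>i\<in>UNIV. \<Sum>j\<in>UNIV. \<bar>M $ i $ j\<bar>)"
  \<comment> \<open>\<open>r q\<close> is the lattice point nearest to q x. These points leave every
    bounded set as q grows, since some coordinate of x is nonzero.\<close>
  define r where "r q = (\<chi> i. round (real q * x $ i))" for q :: nat
  have "x \<bullet> ((M + transpose M) *v x) = 2 * (x \<bullet> (M *v x))"
    by (simp add: inner_add_right matrix_vector_mult_add_rdistrib)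
       (metis dot_lmul_matrix inner_commute transpose_matrix_vector)
  then have x0: "x \<bullet> (M *v x) = 0"
    by (simp add: ker)
  have "rvec (r q) \<bullet> (M *v rvec (r q)) \<le> K" for q
  proof -
    define d where "d = rvec (r q) - real q *\<^sub>R x"
    have "\<bar>d $ i\<bar> \<le> 1/2" for i
      using of_int_round_abs_le[of "real q * x $ i"] by (simp add: d_def r_def)
    then have d1: "\<bar>d $ i\<bar> \<le> 1" for i
      by (rule order_trans) simp
    have "rvec (r q) = d + real q *\<^sub>R x"
      by (simp add: d_def)
    \<comment> \<open>The cross term vanishes because x lies in the kernel, and the term in q^2
      because of \<open>x0\<close>. Only the bounded rounding error \<open>d\<close> remains, so the
      estimate is uniform in q.\<close>
    then have "rvec (r q) \<bullet> (M *v rvec (r q)) = d \<bullet> (M *v d)"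
      by (simp add: quadratic_form_add matrix_vector_mult_scaleR ker x0)
    then show ?thesis
      using quadratic_form_abs_le[OF d1, of M] by (simp add: K_def)
  qed
  then have "range r \<subseteq> {n. exp (- pi * (rvec n \<bullet> (M *v rvec n))) \<ge> exp (- pi * K)}"
    by auto
  moreover have "finite {n. exp (- pi * (rvec n \<bullet> (M *v rvec n))) \<ge> exp (- pi * K)}"
    by (rule finite_summable_ge[OF sm]) auto
  ultimately have "finite (range r)"
    by (rule finite_subset)
  then have "finite ((\<lambda>m. \<bar>m $ i\<bar>) ` range r)"
    by simp
  then obtain B where "\<And>z. z \<in> (\<lambda>m. \<bar>m $ i\<bar>) ` range r \<Longrightarrow> z \<le> B"
    by (meson bdd_above_finite bdd_above.E)
  then have B: "\<bar>r q $ i\<bar> \<le> B" for q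
    by simp
  obtain q :: nat where q: "real q > (of_int B + 1) / \<bar>x $ i\<bar>"
    using reals_Archimedean2 by blast
  then have "real q * \<bar>x $ i\<bar> > of_int B + 1"
    using i by (simp add: field_simps)
  moreover have "\<bar>real q * x $ i\<bar> \<le> real_of_int \<bar>r q $ i\<bar> + 1/2"
  proof -
    have "\<bar>real q * x $ i\<bar> - \<bar>real_of_int (r q $ i)\<bar> \<le> \<bar>real_of_int (r q $ i) - real q * x $ i\<bar>"
      by (rule abs_triangle_ineq2_sym)
    also have "\<dots> \<le> 1/2"
      unfolding r_def vec_lambda_beta by (rule of_int_round_abs_le)
    finally show ?thesis by simp
  qed
  moreover have "real_of_int \<bar>r q $ i\<bar> \<le> of_int B"
    using B by (simp only: of_int_le_iff)
  ultimately show False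
    by (simp add: abs_mult)
qed

text \<open>Completing the square: shifting the summation index by \<open>m\<close> produces the linear
  exponent \<open>(M + M\<^sup>t) m\<close>, and these directions dominate the \<open>l\<^sup>1\<close> norm.\<close>

lemma gauss_sum_l1norm_summable:
  fixes M :: "real ^ 'n ^ 'n"
  assumes sm: "(\<lambda>n. exp (- pi * (rvec n \<bullet> (M *v rvec n)))) summable_on UNIV"
  shows "(\<lambda>n. exp (- pi * (rvec n \<bullet> (M *v rvec n)) + R * l1norm (rvec n))) summable_on UNIV"
proof -
  define S where "S = M + transpose M"
  define K where "K = (\<Sum>i\<in>UNIV. \<Sum>j\<in>UNIV. \<bar>S $ i $ j\<bar>)"
  have "inj ((*v) S)"
    using gauss_sum_symmetrized_inj[OF sm] by (auto simp: vec.inj_iff_eq_0 S_def)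
  then have "surj ((*v) S)"
    using linear_injective_imp_surjective[OF matrix_vector_mul_linear] by blast
  \<comment> \<open>One sign vector for each orthant; coding patterns as functions to
    \<open>bool\<close> makes \<open>UNIV\<close> a finite index set.\<close>
  define sg :: "('n \<Rightarrow> bool) \<Rightarrow> real ^ 'n" where "sg \<sigma> = (\<chi> i. if \<sigma> i then 1 else - 1)" for \<sigma>
  \<comment> \<open>The target exceeds |R| by K, the most that rounding the real solution can cost.
    Hence each coordinate of \<open>S *v rvec m\<close> is at least |R| in the direction of its
    prescribed sign.\<close>
  have "\<exists>m. \<forall>i. \<bar>(S *v rvec m) $ i - (\<bar>R\<bar> + K) * sg \<sigma> $ i\<bar> \<le> K" for \<sigma>
  proof -
    obtain x where x: "S *v x = (\<bar>R\<bar> + K) *\<^sub>R sg \<sigma>"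
      using \<open>surj ((*v) S)\<close> by (metis surjD)
    define m where "m = (\<chi> i. round (x $ i))"
    have d: "\<bar>(rvec m - x) $ j\<bar> \<le> 1" for j
      using of_int_round_abs_le[of "x $ j"] by (simp add: m_def)
    have "\<bar>(S *v rvec m) $ i - (\<bar>R\<bar> + K) * sg \<sigma> $ i\<bar> \<le> K" for i
    proof -
      have "(S *v rvec m) $ i - (\<bar>R\<bar> + K) * sg \<sigma> $ i = (S *v (rvec m - x)) $ i"
        by (simp add: matrix_vector_mult_diff_distrib x)
      also have "\<bar>\<dots>\<bar> \<le> (\<Sum>j\<in>UNIV. \<bar>S $ i $ j\<bar>)"
        unfolding matrix_vector_mult_def
        using d by (auto simp: abs_mult intro!: order_trans[OF sum_abs] sum_mono mult_left_le)
      also have "\<dots> \<le> K"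
        unfolding K_def by (intro member_le_sum) (auto intro: sum_nonneg)
      finally show ?thesis .
    qed
    then show ?thesis by blast
  qed
  then obtain m where m: "\<And>\<sigma> i. \<bar>(S *v rvec (m \<sigma>)) $ i - (\<bar>R\<bar> + K) * sg \<sigma> $ i\<bar> \<le> K"
    by metis
  let ?Q = "\<lambda>n. rvec n \<bullet> (M *v rvec n)"
  have shift: "?Q (n - k) = ?Q n - rvec n \<bullet> (S *v rvec k) + ?Q k" for n k
    using quadratic_form_add[of "rvec n" "- rvec k" M]
    by (simp add: S_def rvec_diff vec.neg)
  \<comment> \<open>The summand for the sign pattern of \<open>n\<close> already dominates; adding
    the other patterns gives one majorant for all orthants.\<close>
  have bound: "exp (- pi * ?Q n + R * l1norm (rvec n)) \<le>
      (\<Sum>\<sigma>\<in>UNIV. exp (pi * ?Q (m \<sigma>)) * exp (- pi * ?Q (n - m \<sigma>)))" for n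
  proof -
    define \<sigma> where "\<sigma> i \<longleftrightarrow> n $ i \<ge> 0" for i
    have "\<bar>R\<bar> * \<bar>real_of_int (n $ i)\<bar> \<le> of_int (n $ i) * (S *v rvec (m \<sigma>)) $ i" for i
    proof -
      define a where "a = (S *v rvec (m \<sigma>)) $ i"
      show ?thesis
      proof (cases "n $ i \<ge> 0")
        case True
        then have "a \<ge> \<bar>R\<bar>"
          using m[of \<sigma> i] by (simp add: sg_def \<sigma>_def a_def)
        then have "real_of_int (n $ i) * \<bar>R\<bar> \<le> real_of_int (n $ i) * a"
          using True by (intro mult_left_mono) auto
        then show ?thesis
          using True by (simp add: a_def mult.commute)
      next
        case False
        then have "a \<le> - \<bar>R\<bar>"
          using m[of \<sigma> i] by (simp add: sg_def \<sigma>_def a_def)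
        then have "(- real_of_int (n $ i)) * \<bar>R\<bar> \<le> (- of_int (n $ i)) * (- a)"
          using False by (intro mult_left_mono) auto
        then show ?thesis
          using False by (simp add: a_def mult.commute)
      qed
    qed
    then have "\<bar>R\<bar> * l1norm (rvec n) \<le> rvec n \<bullet> (S *v rvec (m \<sigma>))"
      by (simp add: l1norm_def inner_vec_def sum_distrib_left sum_mono)
    moreover have "R * l1norm (rvec n) \<le> \<bar>R\<bar> * l1norm (rvec n)"
      by (intro mult_right_mono l1norm_nonneg) auto
    moreover have "\<bar>R\<bar> * l1norm (rvec n) \<le> pi * (\<bar>R\<bar> * l1norm (rvec n))"
      using mult_right_mono[of 1 pi "\<bar>R\<bar> * l1norm (rvec n)"] l1norm_nonneg[of "rvec n"] pi_gt3 by simp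
    moreover have "pi * (\<bar>R\<bar> * l1norm (rvec n)) \<le> pi * (rvec n \<bullet> (S *v rvec (m \<sigma>)))"
      using calculation(1) by (intro mult_left_mono) auto
    ultimately have "R * l1norm (rvec n) \<le> pi * (rvec n \<bullet> (S *v rvec (m \<sigma>)))"
      by linarith
    then have "exp (- pi * ?Q n + R * l1norm (rvec n)) \<le> exp (pi * ?Q (m \<sigma>) + - pi * ?Q (n - m \<sigma>))"
      by (simp add: shift algebra_simps)
    also have "\<dots> \<le> (\<Sum>\<sigma>\<in>UNIV. exp (pi * ?Q (m \<sigma>)) * exp (- pi * ?Q (n - m \<sigma>)))"
      unfolding exp_add by (rule member_le_sum) auto
    finally show ?thesis .
  qed
  have "(\<lambda>n. exp (- pi * ?Q (n - k))) summable_on UNIV" for k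
    using summable_on_reindex_bij_betw[OF bij_diff_right[of k], of "\<lambda>n. exp (- pi * ?Q n)"] sm by simp
  then have "(\<lambda>n. \<Sum>\<sigma>\<in>UNIV. exp (pi * ?Q (m \<sigma>)) * exp (- pi * ?Q (n - m \<sigma>))) summable_on UNIV"
    by (intro summable_on_finite_sum summable_on_cmult_right) auto
  then show ?thesis
    by (rule summable_on_comparison_test[OF _ bound]) auto
qed

section \<open>Termwise differentiation of Fourier series with rapidly decaying coefficients\<close>

lemma norm_dotp_cvec_le: "norm (dotp (cvec n) w) \<le> l1norm (rvec n) * (\<Sum>i\<in>UNIV. norm (w $ i))"
proof -
  have "norm (dotp (cvec n) w) \<le> (\<Sum>i\<in>UNIV. \<bar>real_of_int (n $ i)\<bar> * norm (w $ i))"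
    unfolding dotp_def by (rule order_trans[OF norm_sum]) (simp add: norm_mult)
  also have "\<dots> \<le> (\<Sum>i\<in>UNIV. \<bar>real_of_int (n $ i)\<bar> * (\<Sum>i\<in>UNIV. norm (w $ i)))"
    by (intro sum_mono mult_left_mono member_le_sum) auto
  finally show ?thesis
    by (simp add: l1norm_def sum_distrib_right)
qed

lemma dotp_add_scale: "dotp a (v + t *s d) = dotp a v + t * dotp a d"
  by (simp add: dotp_def algebra_simps sum.distrib sum_distrib_left)

definition fourier_series :: "(int ^ 'n \<Rightarrow> complex) \<Rightarrow> complex ^ 'n \<Rightarrow> complex" where
  "fourier_series c v = (\<Sum>\<^sub>\<infinity>n\<in>UNIV. c n * exp (2 * \<i> * of_real pi * dotp (cvec n) v))"

text \<open>All exponential rates are demanded at once: the terms grow exponentially in n at complex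
  arguments, and differentiation must not leave the class.\<close>

definition rapidly_decaying :: "(int ^ 'n \<Rightarrow> complex) \<Rightarrow> bool" where
  "rapidly_decaying c \<longleftrightarrow> (\<forall>R. (\<lambda>n. norm (c n) * exp (R * l1norm (rvec n))) summable_on UNIV)"

definition diff_coeff :: "complex ^ 'n \<Rightarrow> (int ^ 'n \<Rightarrow> complex) \<Rightarrow> int ^ 'n \<Rightarrow> complex" where
  "diff_coeff d c n = 2 * \<i> * of_real pi * dotp (cvec n) d * c n"

text \<open>The new factor grows at most linearly in the l1 norm of n, and x <= exp x absorbs it
  when the rate is raised from R to R + 1.\<close>

lemma rapidly_decaying_diff_coeff:
  assumes "rapidly_decaying c"
  shows "rapidly_decaying (diff_coeff d c)"
  unfolding rapidly_decaying_def
proof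
  fix R
  define K where "K = 2 * pi * (\<Sum>i\<in>UNIV. norm (d $ i))"
  have K: "K \<ge> 0"
    by (simp add: K_def sum_nonneg)
  have sm: "(\<lambda>n. K * (norm (c n) * exp ((R + 1) * l1norm (rvec n)))) summable_on UNIV"
    using assms unfolding rapidly_decaying_def by (intro summable_on_cmult_right) blast
  show "(\<lambda>n. norm (diff_coeff d c n) * exp (R * l1norm (rvec n))) summable_on UNIV"
  proof (rule summable_on_comparison_test[OF sm])
    fix n
    have "norm (diff_coeff d c n) = 2 * pi * norm (dotp (cvec n) d) * norm (c n)"
      by (simp add: diff_coeff_def norm_mult)
    also have "\<dots> \<le> 2 * pi * (l1norm (rvec n) * (\<Sum>i\<in>UNIV. norm (d $ i))) * norm (c n)"
      by (intro mult_right_mono mult_left_mono norm_dotp_cvec_le) auto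
    also have "\<dots> = K * l1norm (rvec n) * norm (c n)"
      by (simp add: K_def)
    also have "\<dots> \<le> K * exp (l1norm (rvec n)) * norm (c n)"
    proof -
      have "l1norm (rvec n) \<le> exp (l1norm (rvec n))"
        using exp_ge_add_one_self[of "l1norm (rvec n)"] by linarith
      then show ?thesis
        using K by (intro mult_right_mono mult_left_mono) auto
    qed
    finally have "norm (diff_coeff d c n) * exp (R * l1norm (rvec n)) \<le>
        K * exp (l1norm (rvec n)) * norm (c n) * exp (R * l1norm (rvec n))"
      by (rule mult_right_mono) auto
    then show "norm (diff_coeff d c n) * exp (R * l1norm (rvec n)) \<le>
        K * (norm (c n) * exp ((R + 1) * l1norm (rvec n)))"
      unfolding distrib_right exp_add by (simp add: mult_ac)
  qed auto
qed

lemma norm_fourier_term_le: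
  "norm (c n * exp (2 * \<i> * of_real pi * dotp (cvec n) v)) \<le>
    norm (c n) * exp (2 * pi * (\<Sum>i\<in>UNIV. norm (v $ i)) * l1norm (rvec n))"
proof -
  have "norm (exp (2 * \<i> * of_real pi * dotp (cvec n) v)) \<le> exp (norm (2 * \<i> * of_real pi * dotp (cvec n) v))"
    by (rule norm_exp)
  also have "\<dots> \<le> exp (2 * pi * (l1norm (rvec n) * (\<Sum>i\<in>UNIV. norm (v $ i))))"
    using norm_dotp_cvec_le[of n v] by (simp add: norm_mult)
  also have "2 * pi * (l1norm (rvec n) * (\<Sum>i\<in>UNIV. norm (v $ i))) =
      2 * pi * (\<Sum>i\<in>UNIV. norm (v $ i)) * l1norm (rvec n)"
    by (simp only: mult_ac)
  finally show ?thesis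
    unfolding norm_mult by (rule mult_left_mono) simp
qed

lemma fourier_series_has_sum:
  assumes "rapidly_decaying c"
  shows "((\<lambda>n. c n * exp (2 * \<i> * of_real pi * dotp (cvec n) v)) has_sum fourier_series c v) UNIV"
proof -
  have "(\<lambda>n. norm (c n * exp (2 * \<i> * of_real pi * dotp (cvec n) v))) summable_on UNIV"
    using assms unfolding rapidly_decaying_def
    by (intro summable_on_comparison_test[OF _ norm_fourier_term_le]) auto
  then show ?thesis
    unfolding fourier_series_def by (rule has_sum_infsum[OF abs_summable_summable])
qed

text \<open>The partial sums are holomorphic and converge uniformly on a disc by the Weierstrass
  M-test, so their derivatives converge to the derivative of the limit.\<close>

lemma fourier_series_has_field_derivative:
  assumes c: "rapidly_decaying c"
  shows "((\<lambda>t. fourier_series c (v + t *s d)) has_field_derivative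
    fourier_series (diff_coeff d c) (v + t *s d)) (at t)"
proof -
  \<comment> \<open>This radius makes t an interior point of the disc.\<close>
  define r where "r = norm t + 1"
  define f where "f n t = c n * exp (2 * \<i> * of_real pi * dotp (cvec n) (v + t *s d))" for n t
  define f' where "f' n t = diff_coeff d c n * exp (2 * \<i> * of_real pi * dotp (cvec n) (v + t *s d))" for n t
  define R where "R = 2 * pi * (\<Sum>i\<in>UNIV. norm (v $ i) + r * norm (d $ i))"
  have f: "(f n has_field_derivative f' n w) (at w)" for n w
    unfolding f_def f'_def dotp_add_scale diff_coeff_def
    by (auto intro!: derivative_eq_intros)
  have ul: "uniform_limit (cball 0 r) (\<lambda>X w. \<Sum>n\<in>X. f n w) (\<lambda>w. fourier_series c (v + w *s d))
      (finite_subsets_at_top UNIV)"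
  proof (rule Weierstrass_m_test_general')
    show "(\<lambda>n. norm (c n) * exp (R * l1norm (rvec n))) summable_on UNIV"
      using c by (auto simp: rapidly_decaying_def)
    show "((\<lambda>n. f n w) has_sum fourier_series c (v + w *s d)) UNIV" for w
      unfolding f_def by (rule fourier_series_has_sum[OF c])
    fix n w assume w: "w \<in> cball (0::complex) r"
    have "norm (f n w) \<le> norm (c n) * exp (2 * pi * (\<Sum>i\<in>UNIV. norm ((v + w *s d) $ i)) * l1norm (rvec n))"
      unfolding f_def by (rule norm_fourier_term_le)
    also have "\<dots> \<le> norm (c n) * exp (R * l1norm (rvec n))"
    proof -
      have "norm ((v + w *s d) $ i) \<le> norm (v $ i) + r * norm (d $ i)" for i
      proof -
        have "norm (w * d $ i) \<le> r * norm (d $ i)"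
          using w by (simp add: norm_mult mult_right_mono)
        then show ?thesis
          using norm_triangle_ineq[of "v $ i" "w * d $ i"] by simp
      qed
      then show ?thesis
        unfolding R_def
        by (intro mult_left_mono exp_le_cancel_iff[THEN iffD2] mult_right_mono sum_mono l1norm_nonneg) auto
    qed
    finally show "norm (f n w) \<le> norm (c n) * exp (R * l1norm (rvec n))" .
  qed
  have deriv: "continuous_on (cball 0 r) (\<lambda>w. \<Sum>n\<in>X. f n w) \<and>
      (\<forall>w\<in>ball 0 r. ((\<lambda>w. \<Sum>n\<in>X. f n w) has_field_derivative (\<Sum>n\<in>X. f' n w)) (at w))" for X
  proof -
    have "((\<lambda>w. \<Sum>n\<in>X. f n w) has_field_derivative (\<Sum>n\<in>X. f' n w)) (at w)" for w
      by (intro DERIV_sum f)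
    then show ?thesis
      by (intro conjI ballI DERIV_continuous_on[OF has_field_derivative_at_within])
  qed
  have r: "r > 0"
    by (simp add: r_def add_nonneg_pos)
  have "\<exists>g'. \<forall>w\<in>ball 0 r.
      ((\<lambda>w. fourier_series c (v + w *s d)) has_field_derivative g' w) (at w) \<and>
      ((\<lambda>X. \<Sum>n\<in>X. f' n w) \<longlongrightarrow> g' w) (finite_subsets_at_top UNIV)"
    by (rule has_complex_derivative_uniform_limit[OF always_eventually[OF allI[OF deriv]] ul
          finite_subsets_at_top_neq_bot r]) (rule exI, rule ballI)
  then obtain g' where g': "\<forall>w\<in>ball 0 r.
      ((\<lambda>w. fourier_series c (v + w *s d)) has_field_derivative g' w) (at w) \<and>
      ((\<lambda>X. \<Sum>n\<in>X. f' n w) \<longlongrightarrow> g' w) (finite_subsets_at_top UNIV)" ..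
  \<comment> \<open>The limit theorem only provides some derivative \<open>g'\<close>; uniqueness of
    limits identifies it with the differentiated series.\<close>
  have "((\<lambda>X. \<Sum>n\<in>X. f' n t) \<longlongrightarrow> fourier_series (diff_coeff d c) (v + t *s d)) (finite_subsets_at_top UNIV)"
    using fourier_series_has_sum[OF rapidly_decaying_diff_coeff[OF c], where v="v + t *s d"]
    unfolding f'_def has_sum_def .
  moreover have t: "t \<in> ball 0 r"
    by (simp add: r_def)
  ultimately have "g' t = fourier_series (diff_coeff d c) (v + t *s d)"
    using tendsto_unique[OF finite_subsets_at_top_neq_bot] bspec[OF g' t] by blast
  then show ?thesis
    using bspec[OF g' t] by simp
qed

definition theta_coeff :: "complex ^ 'n ^ 'n \<Rightarrow> int ^ 'n \<Rightarrow> complex" where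
  "theta_coeff T n = exp (\<i> * of_real pi * dotp (cvec n) (T *v cvec n))"

lemma theta_eq_fourier_series: "theta T v = fourier_series (theta_coeff T) v"
  by (simp add: theta_def fourier_series_def theta_coeff_def exp_add)

text \<open>Since \<open>infsum\<close> of a divergent family is \<open>0\<close>, a nonzero value of \<open>theta\<close> already
  forces convergence, and then the shift argument gives convergence everywhere.\<close>

lemma theta_nonzero_imp_rapidly_decaying:
  assumes T: "\<And>i j. Re (T $ i $ j) = 0" and nz: "theta T v \<noteq> 0"
  shows "rapidly_decaying (theta_coeff T)"
proof -
  define M where "M = (\<chi> i j. Im (T $ i $ j))"
  define l where "l n = (\<Sum>i\<in>UNIV. real_of_int (n $ i) * Im (v $ i))" for n
  have Q: "norm (theta_coeff T n) = exp (- pi * (rvec n \<bullet> (M *v rvec n)))" for n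
    using T by (simp add: theta_coeff_def norm_exp_eq_Re dotp_def matrix_vector_mult_def M_def
        inner_vec_def Im_sum sum_distrib_left)
  have norm_term: "norm (theta_coeff T n * exp (2 * \<i> * of_real pi * dotp (cvec n) v)) =
      exp (- pi * (rvec n \<bullet> (M *v rvec n))) * exp (- 2 * pi * l n)" for n
    by (simp add: norm_mult Q norm_exp_eq_Re dotp_def Im_sum l_def)
  have "(\<lambda>n. theta_coeff T n * exp (2 * \<i> * of_real pi * dotp (cvec n) v)) summable_on UNIV"
    using nz infsum_not_exists unfolding theta_eq_fourier_series fourier_series_def by blast
  \<comment> \<open>Summable complex families are absolutely summable, so the terms may be replaced
    by their norms.\<close>
  then have s1: "(\<lambda>n. exp (- pi * (rvec n \<bullet> (M *v rvec n))) * exp (- 2 * pi * l n)) summable_on UNIV"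
    unfolding summable_on_iff_abs_summable_on_complex norm_term .
  have neg: "rvec (- n) = - rvec n" "l (- n) = - l n" for n
    by (simp_all add: vec_eq_iff l_def sum_negf)
  \<comment> \<open>The Gaussian is even and \<open>l\<close> is odd, so n -> -n reverses the
    exponential tilt.\<close>
  have s2: "(\<lambda>n. exp (- pi * (rvec n \<bullet> (M *v rvec n))) * exp (2 * pi * l n)) summable_on UNIV"
    using summable_on_reindex_bij_betw[OF bij_uminus, of "\<lambda>n. exp (- pi * (rvec n \<bullet> (M *v rvec n))) * exp (- 2 * pi * l n)"] s1
    by (simp add: neg vec.neg)
  \<comment> \<open>One of exp(-t) and exp(t) is at least 1, so the two tilted Gaussians together
    dominate the untilted one.\<close>
  have "(\<lambda>n. exp (- pi * (rvec n \<bullet> (M *v rvec n)))) summable_on UNIV"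
  proof (rule summable_on_comparison_test[OF summable_on_add[OF s1 s2]])
    fix n
    have "1 \<le> exp (- t) + exp t" for t :: real
      using exp_ge_zero[of t] exp_ge_zero[of "- t"] one_le_exp_iff[of t] one_le_exp_iff[of "- t"]
      by linarith
    from this[of "2 * pi * l n"] have "1 \<le> exp (- 2 * pi * l n) + exp (2 * pi * l n)"
      by simp
    then show "exp (- pi * (rvec n \<bullet> (M *v rvec n))) \<le>
        exp (- pi * (rvec n \<bullet> (M *v rvec n))) * exp (- 2 * pi * l n) +
        exp (- pi * (rvec n \<bullet> (M *v rvec n))) * exp (2 * pi * l n)"
      unfolding distrib_left [symmetric] by (simp add: mult_le_cancel_left1)
  qed auto
  from gauss_sum_l1norm_summable[OF this] show ?thesis
    unfolding rapidly_decaying_def Q exp_add by blast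
qed

section \<open>The curve and its periods\<close>

lemma pos_bij: "bij_betw (pos :: 'g::{finite,linorder} \<Rightarrow> nat) UNIV {1..CARD('g)}"
proof -
  have mono: "pos j < pos k" if "j < k" for j k :: 'g
    unfolding pos_def using that
    by (intro psubset_card_mono psubsetI) (auto simp: set_eq_iff not_le intro!: exI[of _ k])
  then have "inj (pos :: 'g \<Rightarrow> nat)"
    by (metis injI linorder_less_linear order_less_irrefl)
  moreover have "pos k \<in> {1..CARD('g)}" for k :: 'g
  proof -
    have "card {k} \<le> pos k" "pos k \<le> CARD('g)"
      unfolding pos_def by (intro card_mono; auto)+
    then show ?thesis by simp
  qed
  moreover have "card (range (pos :: 'g \<Rightarrow> nat)) = card {1..CARD('g)}"
    using calculation(1) by (simp add: card_image)
  ultimately show ?thesis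
    unfolding bij_betw_def by (intro conjI card_subset_eq) auto
qed

lemma pos_range: "1 \<le> pos (k :: 'g::{finite,linorder})" "pos k \<le> CARD('g)"
  using pos_bij[where 'g='g] by (auto simp: bij_betw_def)

lemma pos_inj: "inj (pos :: 'g::{finite,linorder} \<Rightarrow> nat)"
  using pos_bij by (auto simp: bij_betw_def)

section \<open>Real factorization of the curve polynomial and its signs on the real axis\<close>

lemma poly_map_poly_of_real: "poly (map_poly of_real p) (of_real x :: complex) = of_real (poly p x)"
  by (induction p) (auto simp: map_poly_pCons)

text \<open>Both sides are monic of degree 2g+1 and agree at the 2g+1 distinct branch points.
  Counting thus turns the condition on the zero set into a factorization with simple roots.\<close>

lemma real_curve_poly_eq:
  assumes "real_curve lam g e"
  shows "(monom 1 (2 * g + 1) + (\<Sum>i\<le>2 * g. monom (lam (2 * i + 2)) (2 * g - i))) =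
    map_poly complex_of_real (\<Prod>k\<in>{1..2 * g + 1}. [:- e k, 1:])" (is "?P = map_poly _ ?R")
proof (rule poly_eqI_degree_lead_coeff)
  let ?A = "(\<lambda>k. complex_of_real (e k)) ` {1..2 * g + 1}"
  have e: "strict_mono_on {1..2 * g + 1} e" and roots: "{x. curve_poly lam g x = 0} = ?A"
    using assms by (auto simp: real_curve_def)
  have poly: "poly ?P x = curve_poly lam g x" for x
    by (simp add: curve_poly_def poly_monom poly_sum)
  have deg: "degree ?R = 2 * g + 1"
    by (subst degree_prod_eq_sum_degree) auto
  have "lead_coeff ?R = 1"
    by (simp add: lead_coeff_prod del: prod.cl_ivl_Suc)
  with deg have "poly.coeff ?R (2 * g + 1) = 1"
    by simp
  moreover have "(\<Sum>i\<le>2 * g. poly.coeff (monom (lam (2 * i + 2)) (2 * g - i)) (2 * g + 1)) = 0"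
    by (intro sum.neutral) auto
  ultimately show "poly.coeff ?P (2 * g + 1) = poly.coeff (map_poly complex_of_real ?R) (2 * g + 1)"
    by (simp only: coeff_add coeff_sum coeff_map_poly of_real_0) simp
  have "inj_on (\<lambda>k. complex_of_real (e k)) {1..2 * g + 1}"
    using strict_mono_on_imp_inj_on[OF e] by (auto simp: inj_on_def)
  then show "2 * g + 1 \<le> card ?A"
    by (simp add: card_image)
  show "degree ?P \<le> 2 * g + 1"
    by (intro degree_add_le degree_sum_le) (auto intro: order_trans[OF degree_monom_le])
  show "degree (map_poly complex_of_real ?R) \<le> 2 * g + 1"
    using deg by (simp add: degree_map_poly)
  show "poly ?P z = poly (map_poly complex_of_real ?R) z" if z: "z \<in> ?A" for z
  proof -
    obtain k where k: "k \<in> {1..2 * g + 1}" "z = of_real (e k)"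
      using z by auto
    have "poly ?R (e k) = 0"
      using k(1) by (auto simp: poly_prod simp del: prod.cl_ivl_Suc)
    moreover have "curve_poly lam g z = 0"
      using z roots by blast
    ultimately show ?thesis
      by (simp only: poly k(2) poly_map_poly_of_real of_real_0)
  qed
qed

text \<open>\<open>lam (2 * j)\<close> is the coefficient of x^(2g+1-j) in a product of real linear
  factors. This makes \<open>dr\<close> real on the cuts.\<close>

lemma real_curve_lam_real:
  assumes "real_curve lam g e" "j \<le> 2 * g + 1"
  shows "lam (2 * j) \<in> \<real>"
proof (cases j)
  case 0
  then show ?thesis using assms by (simp add: real_curve_def)
next
  case (Suc i)
  then have i: "i \<le> 2 * g" using assms by simp
  have "poly.coeff (monom 1 (2 * g + 1) + (\<Sum>i\<le>2 * g. monom (lam (2 * i + 2)) (2 * g - i))) (2 * g - i)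
      = (\<Sum>k\<le>2 * g. poly.coeff (monom (lam (2 * k + 2)) (2 * g - k)) (2 * g - i))"
    by (simp add: coeff_sum)
  also have "\<dots> = (\<Sum>k\<le>2 * g. if k = i then lam (2 * k + 2) else 0)"
    using i by (intro sum.cong) auto
  also have "\<dots> = lam (2 * j)"
    using i Suc by simp
  finally have "lam (2 * j) = of_real (poly.coeff (\<Prod>k\<in>{1..2 * g + 1}. [:- e k, 1:]) (2 * g - i))"
    unfolding real_curve_poly_eq[OF assms(1)] by (simp only: coeff_map_poly of_real_0)
  then show ?thesis
    by simp
qed

lemma real_curve_prod:
  assumes "real_curve lam g e"
  shows "curve_poly lam g (of_real x) = of_real (\<Prod>k\<in>{1..2 * g + 1}. x - e k)"
proof -
  have "curve_poly lam g (of_real x) = poly (monom 1 (2 * g + 1) + (\<Sum>i\<le>2 * g. monom (lam (2 * i + 2)) (2 * g - i))) (of_real x)"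
    by (simp add: curve_poly_def poly_monom poly_sum)
  also have "\<dots> = of_real (\<Prod>k\<in>{1..2 * g + 1}. x - e k)"
    unfolding real_curve_poly_eq[OF assms] poly_map_poly_of_real by (simp add: poly_prod add.commute del: prod.cl_ivl_Suc)
  finally show ?thesis .
qed

lemma real_curve_less:
  assumes "real_curve lam g e" "1 \<le> i" "i < j" "j \<le> 2 * g + 1"
  shows "e i < e j"
  using assms by (auto simp: real_curve_def strict_mono_on_def)

lemma real_curve_le:
  assumes "real_curve lam g e" "1 \<le> i" "i \<le> j" "j \<le> 2 * g + 1"
  shows "e i \<le> e j"
  using real_curve_less[OF assms(1,2), of j] assms by (cases "i = j") auto

text \<open>The factors with k > m are nonpositive, and their number 2g+1-m has the parity of m+1.
  So the product is nonnegative on the cuts (m odd) and nonpositive on the gaps (m even).\<close>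

lemma real_curve_prod_sign:
  assumes "real_curve lam g e" "1 \<le> m" "m \<le> 2 * g" "x \<in> {e m..e (m + 1)}"
  shows "(- 1) ^ (m + 1) * (\<Prod>k\<in>{1..2 * g + 1}. x - e k) \<ge> 0"
proof -
  have "(\<Prod>k\<in>{1..2 * g + 1}. x - e k) = (\<Prod>k\<in>{1..m}. x - e k) * (\<Prod>k\<in>{m+1..2 * g + 1}. x - e k)"
    using assms by (subst prod.union_disjoint [symmetric]) (auto intro!: prod.cong simp del: prod.cl_ivl_Suc)
  also have "(\<Prod>k\<in>{m+1..2 * g + 1}. x - e k) = (\<Prod>k\<in>{m+1..2 * g + 1}. (- 1) * (e k - x))"
    by (intro prod.cong) auto
  also have "\<dots> = (- 1) ^ (2 * g + 1 - m) * (\<Prod>k\<in>{m+1..2 * g + 1}. e k - x)"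
    unfolding prod.distrib by (simp del: prod.cl_ivl_Suc)
  also have "(- 1 :: real) ^ (2 * g + 1 - m) = (- 1) ^ (m + 1)"
    using assms by (auto simp: minus_one_power_iff)
  finally have "(- 1) ^ (m + 1) * (\<Prod>k\<in>{1..2 * g + 1}. x - e k) =
      ((- 1) ^ (m + 1) * (- 1) ^ (m + 1)) * ((\<Prod>k\<in>{1..m}. x - e k) * (\<Prod>k\<in>{m+1..2 * g + 1}. e k - x))"
    by (simp only: mult_ac)
  also have "((- 1) ^ (m + 1) * (- 1) ^ (m + 1) :: real) = 1"
    by (simp flip: power_add mult_2)
  finally show ?thesis
  proof (simp only: mult_1, intro mult_nonneg_nonneg prod_nonneg)
    fix k assume "k \<in> {1..m}"
    then have "e k \<le> e m"
      using assms by (intro real_curve_le[OF assms(1)]) auto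
    then show "0 \<le> x - e k" using assms by auto
  next
    fix k assume "k \<in> {m+1..2 * g + 1}"
    then have "e (m + 1) \<le> e k"
      using assms by (intro real_curve_le[OF assms(1)]) auto
    then show "0 \<le> e k - x" using assms by auto
  qed
qed

lemma power2_eq_nonneg_imp_real:
  assumes "(z :: complex)\<^sup>2 = of_real r" "r \<ge> 0"
  shows "Im z = 0"
proof -
  have "Re z * Im z = 0" "(Re z)\<^sup>2 - (Im z)\<^sup>2 = r"
    using assms by (auto simp: complex_eq_iff power2_eq_square)
  then show ?thesis
    using assms(2) by (metis diff_0 mult_eq_0_iff neg_0_le_iff_le power2_less_eq_zero_iff zero_power2)
qed

lemma power2_eq_nonpos_imp_imaginary:
  assumes "(z :: complex)\<^sup>2 = of_real r" "r \<le> 0"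
  shows "Re z = 0"
  using power2_eq_nonneg_imp_real[of "\<i> * z" "- r"] assms by (simp add: power_mult_distrib)

lemma upper_branch_square:
  assumes "real_curve lam g e" "upper_branch (curve_poly lam g) y"
  shows "(y (of_real x))\<^sup>2 = of_real (\<Prod>k\<in>{1..2 * g + 1}. x - e k)"
  using assms(2) by (simp add: upper_branch_def real_curve_prod[OF assms(1)])

lemma upper_branch_cut_real:
  assumes "real_curve lam g e" "upper_branch (curve_poly lam g) y"
    and "1 \<le> m" "m \<le> 2 * g" "odd m" "x \<in> {e m..e (m + 1)}"
  shows "Im (y (of_real x)) = 0"
  using power2_eq_nonneg_imp_real[OF upper_branch_square[OF assms(1,2)]]
    real_curve_prod_sign[OF assms(1,3,4,6)] assms(5) by simp

lemma upper_branch_gap_imaginary: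
  assumes "real_curve lam g e" "upper_branch (curve_poly lam g) y"
    and "1 \<le> m" "m \<le> 2 * g" "even m" "x \<in> {e m..e (m + 1)}"
  shows "Re (y (of_real x)) = 0"
  using power2_eq_nonpos_imp_imaginary[OF upper_branch_square[OF assms(1,2)]]
    real_curve_prod_sign[OF assms(1,3,4,6)] assms(5) by simp

section \<open>Integrals with inverse square root singularities at the endpoints\<close>

lemma Re_integral:
  assumes "f integrable_on S"
  shows "Re (integral S f) = integral S (\<lambda>x. Re (f x))"
  using integral_linear[OF assms bounded_linear_Re] by (simp add: o_def)

text \<open>If \<open>f\<close> is not integrable, its \<open>integral\<close> is 0 by convention,
  so the claim holds in that case as well.\<close>

lemma Re_integral_eq_0:
  assumes "\<And>x. x \<in> S \<Longrightarrow> Re (f x) = 0"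
  shows "Re (integral S f) = 0"
proof (cases "f integrable_on S")
  case True
  have "integral S (\<lambda>x. Re (f x)) = integral S (\<lambda>x. 0)"
    by (rule integral_cong) (use assms in auto)
  then show ?thesis
    using Re_integral[OF True] by simp
qed (simp add: not_integrable_integral)

lemma Im_integral_eq_0:
  assumes "\<And>x. x \<in> S \<Longrightarrow> Im (f x) = 0"
  shows "Im (integral S f) = 0"
proof (cases "f integrable_on S")
  case True
  have "Im (integral S f) = integral S (\<lambda>x. Im (f x))"
    using integral_linear[OF True bounded_linear_Im] by (simp add: o_def)
  also have "\<dots> = integral S (\<lambda>x. 0)"
    by (rule integral_cong) (use assms in auto)
  finally show ?thesis by simp
qed (simp add: not_integrable_integral)

text \<open>An antiderivative is arcsin composed with the affine map of [a, b] onto [-1, 1]. It is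
  continuous up to the endpoints, where the integrand itself is unbounded nearby.\<close>

lemma inverse_sqrt_integrable:
  fixes a b :: real
  assumes "a < b"
  shows "(\<lambda>x. 1 / sqrt ((x - a) * (b - x))) integrable_on {a..b}"
proof -
  have "((\<lambda>x. 1 / sqrt ((x - a) * (b - x))) has_integral
      arcsin ((2 * b - a - b) / (b - a)) - arcsin ((2 * a - a - b) / (b - a))) {a..b}"
  proof (rule fundamental_theorem_of_calculus_interior)
    show "continuous_on {a..b} (\<lambda>x. arcsin ((2 * x - a - b) / (b - a)))"
      using assms by (intro continuous_on_arcsin continuous_intros) (auto simp: field_simps)
    fix x assume x: "x \<in> {a<..<b}"
    define t where "t = (2 * x - a - b) / (b - a)"
    have t: "- 1 < t" "t < 1"
      using x by (auto simp: t_def field_simps)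
    have "(b - a)\<^sup>2 - (2 * x - a - b)\<^sup>2 = 4 * ((x - a) * (b - x))"
      by (simp add: algebra_simps power2_eq_square)
    moreover have "1 - t\<^sup>2 = ((b - a)\<^sup>2 - (2 * x - a - b)\<^sup>2) / (b - a)\<^sup>2"
      unfolding t_def power_divide using assms by (simp add: field_simps)
    ultimately have "1 - t\<^sup>2 = 4 * ((x - a) * (b - x)) / (b - a)\<^sup>2"
      by simp
    then have sq: "sqrt (1 - t\<^sup>2) = 2 * sqrt ((x - a) * (b - x)) / (b - a)"
      using assms by (simp add: real_sqrt_divide real_sqrt_mult)
    have "((\<lambda>x. (2 * x - a - b) / (b - a)) has_real_derivative 2 / (b - a)) (at x)"
      by (intro DERIV_cdivide) (auto intro!: derivative_eq_intros)
    from DERIV_chain2[where f = arcsin, OF _ this]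
    have "((\<lambda>x. arcsin ((2 * x - a - b) / (b - a))) has_real_derivative
        inverse (sqrt (1 - t\<^sup>2)) * (2 / (b - a))) (at x)"
      using DERIV_arcsin[OF t] by (simp add: t_def)
    also have "inverse (sqrt (1 - t\<^sup>2)) * (2 / (b - a)) = 1 / sqrt ((x - a) * (b - x))"
    proof -
      have "inverse (2 * q / D) * (2 / D) = 1 / q" if "D \<noteq> 0" for q D :: real
        using that by (simp add: field_simps)
      then show ?thesis
        unfolding sq by this (use assms in simp)
    qed
    finally show "((\<lambda>x. arcsin ((2 * x - a - b) / (b - a))) has_vector_derivative
        1 / sqrt ((x - a) * (b - x))) (at x)"
      by (rule has_real_derivative_iff_has_vector_derivative[THEN iffD1])
  qed (use assms in auto)
  then show ?thesis by blast
qed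

text \<open>The quotient is the bounded function p / sqrt r times, up to sign, the integrable
  function of \<open>inverse_sqrt_integrable\<close>.\<close>

lemma integrable_inverse_sqrt_singular:
  fixes p Y r :: "real \<Rightarrow> real"
  assumes "a < b" and p: "continuous_on {a..b} p" and Y: "continuous_on {a..b} Y"
    and r: "continuous_on {a..b} r" "\<And>x. x \<in> {a..b} \<Longrightarrow> r x > 0"
    and sq: "\<And>x. x \<in> {a..b} \<Longrightarrow> (Y x)\<^sup>2 = (x - a) * (b - x) * r x"
  shows "(\<lambda>x. p x / Y x) integrable_on {a..b}"
proof -
  define q where "q x = p x / sqrt (r x)" for x
  have "continuous_on {a..b} q"
    unfolding q_def using r by (intro continuous_intros p r(1)) (auto simp: less_imp_neq[symmetric])
  then have "compact (q ` {a..b})"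
    by (intro compact_continuous_image) auto
  then obtain K where K: "\<And>x. x \<in> {a..b} \<Longrightarrow> \<bar>q x\<bar> \<le> K"
    using compact_imp_bounded by (fastforce simp: bounded_iff)
  show ?thesis
  proof (rule measurable_bounded_by_integrable_imp_integrable)
    show "(\<lambda>x. p x / Y x) \<in> borel_measurable (lebesgue_on {a..b})"
      by (intro borel_measurable_divide continuous_imp_measurable_on_sets_lebesgue p Y) auto
    show "(\<lambda>x. K * (1 / sqrt ((x - a) * (b - x)))) integrable_on {a..b}"
      by (intro integrable_on_mult_right inverse_sqrt_integrable assms)
    fix x assume x: "x \<in> {a..b}"
    have "\<bar>Y x\<bar> = sqrt ((x - a) * (b - x)) * sqrt (r x)"
      using sq[OF x] by (metis real_sqrt_abs real_sqrt_mult)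
    then have "\<bar>p x / Y x\<bar> = \<bar>q x\<bar> * (1 / sqrt ((x - a) * (b - x)))"
      using r(2)[OF x] by (simp add: q_def abs_mult)
    also have "\<dots> \<le> K * (1 / sqrt ((x - a) * (b - x)))"
      using x by (intro mult_right_mono K) auto
    finally show "norm (p x / Y x) \<le> K * (1 / sqrt ((x - a) * (b - x)))"
      by simp
  qed auto
qed

text \<open>Without a root, the intermediate value theorem gives \<open>f\<close> a constant sign,
  and then its integral cannot vanish.\<close>

lemma integral_zero_imp_root:
  fixes f :: "real \<Rightarrow> real"
  assumes "a < b" "continuous_on {a<..<b} f" "f integrable_on {a..b}" "integral {a..b} f = 0"
  obtains (root) x where "x \<in> {a<..<b}" "f x = 0"
proof (rule ccontr)
  assume not: "\<not> thesis"
  have nz: "f x \<noteq> 0" if "x \<in> {a<..<b}" for x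
    using not root that by blast
  have pos_case: False if cont: "continuous_on {a<..<b} h" and int: "h integrable_on {a..b}"
    and "integral {a..b} h = 0" and pos: "\<And>x. x \<in> {a<..<b} \<Longrightarrow> h x > 0" for h :: "real \<Rightarrow> real"
  proof -
    \<comment> \<open>Continuity is known only in the open interval, so strict positivity is
      exploited on the closed middle third.\<close>
    define c d where "c = a + (b - a) / 3" and "d = b - (b - a) / 3"
    have cd: "a < c" "c < d" "d < b"
      using assms(1) by (auto simp: c_def d_def field_simps)
    have sub: "{c..d} \<subseteq> {a<..<b}"
      using cd by auto
    have contcd: "continuous_on {c..d} h"
      using cont sub continuous_on_subset by blast
    have nonneg: "h x \<ge> 0" if "x \<in> {a<..<b}" for x
      using pos[OF that] by simp
    have "integral {c..d} h \<le> integral {a<..<b} h"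
      using sub int nonneg integrable_continuous_interval[OF contcd]
      by (intro integral_subset_le) (simp_all add: integrable_on_open_interval_real)
    also have "\<dots> = 0"
      using that(3) by (simp add: integral_open_interval_real)
    finally have "integral {c..d} h \<le> 0" .
    moreover have "integral {c..d} h \<ge> 0"
      using sub nonneg by (intro integral_nonneg integrable_continuous_interval contcd) blast
    ultimately have "\<forall>x\<in>{c..d}. h x = 0"
      using integral_eq_0_iff[OF contcd cd(2)] sub nonneg by (meson antisym subsetD)
    then have "h c = 0"
      using cd by simp
    then show False
      using pos[of c] cd by simp
  qed
  have conn: "connected (f ` {a<..<b})"
    by (intro connected_continuous_image assms) auto
  have "\<not> (f p < 0 \<and> 0 < f q)" if "p \<in> {a<..<b}" "q \<in> {a<..<b}" for p q
  proof
    assume "f p < 0 \<and> 0 < f q"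
    then have "0 \<in> f ` {a<..<b}"
      using connected_iff_interval[THEN iffD1, OF conn, rule_format, of "f p" "f q" 0] that by simp
    then show False
      using nz by force
  qed
  then have "(\<forall>x\<in>{a<..<b}. f x > 0) \<or> (\<forall>x\<in>{a<..<b}. f x < 0)"
    using nz by (meson linorder_neqE_linordered_idom)
  then show False
  proof
    assume "\<forall>x\<in>{a<..<b}. f x > 0"
    then show False using pos_case[of f] assms by blast
  next
    assume "\<forall>x\<in>{a<..<b}. f x < 0"
    then show False using pos_case[of "\<lambda>x. - f x"] assms
      by (auto simp: continuous_on_minus integrable_neg)
  qed
qed

section \<open>Reality of the periods and invertibility of \<open>omega\<close>\<close>

definition cmat :: "real ^ 'n ^ 'm \<Rightarrow> complex ^ 'n ^ 'm" where
  "cmat A = (\<chi> i j. of_real (A $ i $ j))"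

lemma cmat_nth [simp]: "cmat A $ i $ j = of_real (A $ i $ j)"
  by (simp add: cmat_def)

lemma cmat_mult: "cmat (A ** B) = cmat A ** cmat B"
  by (simp add: vec_eq_iff matrix_matrix_mult_def)

lemma cmat_mat_1: "cmat (mat 1) = mat 1"
  by (simp add: vec_eq_iff mat_def)

lemma matrix_inv_eqI:
  assumes "A ** B = mat 1" "B ** A = mat 1"
  shows "matrix_inv A = B"
  unfolding matrix_inv_def
proof (rule some_equality)
  fix X assume "A ** X = mat 1 \<and> X ** A = mat 1"
  then show "X = B"
    using assms by (metis matrix_mul_assoc matrix_mul_lid matrix_mul_rid)
qed (use assms in auto)

lemma real_divide_branch:
  assumes "Im z = 0" "r \<in> \<real>"
  shows "Im (r / (- 2 * z)) = 0"
proof -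
  have "r / (- 2 * z) \<in> \<real>"
    using assms by (intro Reals_divide Reals_mult) (auto simp: complex_is_Real_iff)
  then show ?thesis
    by (simp add: complex_is_Real_iff)
qed

lemma omega_real:
  fixes n k :: "'g::{finite,linorder}"
  assumes "real_curve lam CARD('g) e" "upper_branch (curve_poly lam CARD('g)) y"
  shows "Im (omega e y $ n $ k) = 0"
proof -
  have "Im (integral {e (2 * pos k - 1)..e (2 * pos k)} (\<lambda>x. du y (complex_of_real x) $ n)) = 0"
  proof (rule Im_integral_eq_0)
    fix x assume "x \<in> {e (2 * pos k - 1)..e (2 * pos k)}"
    then have "Im (y (of_real x)) = 0"
      using pos_range[of k] by (intro upper_branch_cut_real[OF assms, of "2 * pos k - 1"]) auto
    then show "Im (du y (complex_of_real x) $ n) = 0"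
      unfolding du_def vec_lambda_beta by (rule real_divide_branch) (intro Reals_power Reals_of_real)
  qed
  then show ?thesis
    by (simp add: omega_def)
qed

lemma omega'_imaginary:
  fixes n k :: "'g::{finite,linorder}"
  assumes "real_curve lam CARD('g) e" "upper_branch (curve_poly lam CARD('g)) y"
  shows "Re (omega' e y $ n $ k) = 0"
proof -
  have "Re (integral {e (2 * i)..e (2 * i + 1)} (\<lambda>x. du y (complex_of_real x) $ n)) = 0"
    if "i \<in> {pos k..CARD('g)}" for i
  proof (rule Re_integral_eq_0)
    fix x assume "x \<in> {e (2 * i)..e (2 * i + 1)}"
    then have "Re (y (of_real x)) = 0"
      using that pos_range[of k] by (intro upper_branch_gap_imaginary[OF assms, of "2 * i"]) auto
    then show "Re (du y (complex_of_real x) $ n) = 0"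
      by (simp add: du_def Re_divide flip: of_real_power)
  qed
  then show ?thesis
    by (simp add: omega'_def)
qed

lemma eta_real:
  fixes n k :: "'g::{finite,linorder}"
  assumes "real_curve lam CARD('g) e" "upper_branch (curve_poly lam CARD('g)) y"
  shows "Im (eta lam e y $ n $ k) = 0"
proof -
  have "Im (integral {e (2 * pos k - 1)..e (2 * pos k)} (\<lambda>x. dr lam y (complex_of_real x) $ n)) = 0"
  proof (rule Im_integral_eq_0)
    fix x assume "x \<in> {e (2 * pos k - 1)..e (2 * pos k)}"
    then have y: "Im (y (of_real x)) = 0"
      using pos_range[of k] by (intro upper_branch_cut_real[OF assms, of "2 * pos k - 1"]) auto
    have lam: "lam (2 * j) \<in> \<real>" if "j \<in> {0..2 * pos n - 2}" for j
      using that pos_range[of n] by (intro real_curve_lam_real[OF assms(1)]) auto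
    show "Im (dr lam y (complex_of_real x) $ n) = 0"
      unfolding dr_def vec_lambda_beta
      by (rule real_divide_branch[OF y])
         (intro Reals_mult lam sum_in_Reals Reals_power Reals_of_real Reals_of_nat)
  qed
  then show ?thesis
    by (simp add: eta_def)
qed

text \<open>On a cut the square of y splits into the two vanishing endpoint factors and
  \<open>r\<close>, the product of the distances to all other branch points, which stays
  positive.\<close>

lemma branch_quotient_integrable:
  assumes rc: "real_curve lam g e" and ub: "upper_branch (curve_poly lam g) y"
    and m: "1 \<le> m" "m \<le> 2 * g" "odd m" and p: "continuous_on {e m..e (m + 1)} p"
  shows "(\<lambda>x. p x / Re (y (of_real x))) integrable_on {e m..e (m + 1)}"
proof (rule integrable_inverse_sqrt_singular)
  define r where "r x = (\<Prod>k\<in>{1..2 * g + 1} - {m, m + 1}. \<bar>x - e k\<bar>)" for x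
  show "e m < e (m + 1)"
    using m by (intro real_curve_less[OF rc]) auto
  have "continuous_on {z. Im z \<ge> 0} y"
    using ub by (simp add: upper_branch_def)
  then have "continuous_on {e m..e (m + 1)} (\<lambda>x. y (of_real x))"
    by (rule continuous_on_compose2) (auto intro!: continuous_intros)
  then show "continuous_on {e m..e (m + 1)} (\<lambda>x. Re (y (of_real x)))"
    by (rule continuous_on_Re)
  show "continuous_on {e m..e (m + 1)} r"
    unfolding r_def by (intro continuous_intros)
  fix x assume x: "x \<in> {e m..e (m + 1)}"
  have "x \<noteq> e k" if k: "k \<in> {1..2 * g + 1} - {m, m + 1}" for k
  proof (cases "k < m")
    case True
    then have "e k < e m" using k m by (intro real_curve_less[OF rc]) auto
    then show ?thesis using x by auto
  next
    case False
    then have "e (m + 1) < e k" using k m by (intro real_curve_less[OF rc]) auto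
    then show ?thesis using x by auto
  qed
  then show "r x > 0"
    unfolding r_def by (intro prod_pos) auto
  have nonneg: "(\<Prod>k\<in>{1..2 * g + 1}. x - e k) \<ge> 0"
    using real_curve_prod_sign[OF rc m(1,2) x] m(3) by simp
  have Im: "Im (y (of_real x)) = 0"
    by (rule upper_branch_cut_real[OF rc ub m x])
  have "complex_of_real ((Re (y (of_real x)))\<^sup>2) = (y (of_real x))\<^sup>2"
    using Im by (simp add: complex_eq_iff power2_eq_square)
  also have "\<dots> = of_real (\<Prod>k\<in>{1..2 * g + 1}. x - e k)"
    by (rule upper_branch_square[OF rc ub])
  finally have "(Re (y (of_real x)))\<^sup>2 = (\<Prod>k\<in>{1..2 * g + 1}. x - e k)"
    by (simp only: of_real_eq_iff)
  also have "\<dots> = \<bar>\<Prod>k\<in>{1..2 * g + 1}. x - e k\<bar>"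
    using nonneg by simp
  also have "\<dots> = (\<Prod>k\<in>{1..2 * g + 1}. \<bar>x - e k\<bar>)"
    by (rule abs_prod)
  also have "\<dots> = r x * (\<Prod>k\<in>{m, m + 1}. \<bar>x - e k\<bar>)"
    unfolding r_def by (rule prod.subset_diff) (use m in auto)
  also have "(\<Prod>k\<in>{m, m + 1}. \<bar>x - e k\<bar>) = (x - e m) * (e (m + 1) - x)"
    using x by simp
  finally show "(Re (y (of_real x)))\<^sup>2 = (x - e m) * (e (m + 1) - x) * r x"
    by (simp only: mult.commute)
qed (rule p)

text \<open>A linear relation between the rows of \<open>omega\<close> gives a polynomial of degree less
  than \<open>g\<close> with a root inside each of the \<open>g\<close> cuts.\<close>

lemma omega_invertible:
  fixes y :: "complex \<Rightarrow> complex"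
  assumes rc: "real_curve lam CARD('g::{finite,linorder}) e" and ub: "upper_branch (curve_poly lam CARD('g::{finite,linorder})) y"
  shows "\<exists>N :: real ^ 'g::{finite,linorder} ^ 'g::{finite,linorder}. matrix_inv (omega e y) = cmat N \<and>
    cmat N ** omega e y = mat 1"
proof -
  define W :: "real ^ 'g::{finite,linorder} ^ 'g::{finite,linorder}" where "W = (\<chi> n k. Re (omega e y $ n $ k))"
  have W: "omega e y = cmat W"
    using omega_real[OF rc ub] by (simp add: W_def vec_eq_iff complex_eq_iff)
  \<comment> \<open>The real form of \<open>du\<close> on a cut. At the ends, where y = 0, both
    expressions are 0 by the convention for division.\<close>
  define f :: "'g \<Rightarrow> real \<Rightarrow> real" where "f n x = x ^ (CARD('g) - pos n) / (- 2) / Re (y (of_real x))" for n x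
  define a b where "a k = e (2 * pos k - 1)" and "b k = e (2 * pos k)" for k :: 'g
  have cut: "1 \<le> 2 * pos k - 1" "2 * pos k - 1 \<le> 2 * CARD('g)" "odd (2 * pos k - 1)"
    "2 * pos k - 1 + 1 = 2 * pos k" for k :: 'g
    using pos_range[of k] by auto
  have fint: "f n integrable_on {a k..b k}" for n k
    using branch_quotient_integrable[OF rc ub cut(1-3), of k "\<lambda>x. x ^ (CARD('g) - pos n) / (- 2)"]
    unfolding f_def a_def b_def cut(4) by (simp add: continuous_intros)
  have du: "du y (of_real x) $ n = of_real (f n x)" if "x \<in> {a k..b k}" for n k x
  proof -
    have "Im (y (of_real x)) = 0"
      using upper_branch_cut_real[OF rc ub cut(1-3), of x k] that unfolding a_def b_def cut(4) by simp
    then have "y (of_real x) = of_real (Re (y (of_real x)))"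
      by (simp add: complex_eq_iff)
    then show ?thesis
      by (simp add: du_def f_def)
  qed
  have Wf: "W $ n $ k = 2 * integral {a k..b k} (f n)" for n k
  proof -
    have "integral {a k..b k} (\<lambda>x. du y (of_real x) $ n) = integral {a k..b k} (\<lambda>x. of_real (f n x))"
      by (intro integral_cong du)
    also have "\<dots> = of_real (integral {a k..b k} (f n))"
      using integral_linear[OF fint bounded_linear_of_real] by (simp add: o_def)
    finally show ?thesis
      by (simp add: W_def omega_def a_def b_def)
  qed
  have "c = 0" if c: "transpose W *v c = 0" for c
  proof -
    \<comment> \<open>The combination of the differentials with coefficients \<open>c\<close> is p
      dx / (-2y), and its integral over every cut is 0.\<close>
    define p where "p = (\<Sum>n\<in>UNIV. monom (c $ n) (CARD('g) - pos n))"
    have "\<exists>x\<in>{a k<..<b k}. poly p x = 0" for k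
    proof -
      have ab: "a k < b k"
        unfolding a_def b_def using pos_range[of k] by (intro real_curve_less[OF rc]) auto
      have Fp: "(\<Sum>n\<in>UNIV. c $ n * f n x) = poly p x / (- 2) / Re (y (of_real x))" for x
        by (simp add: p_def f_def poly_sum poly_monom sum_divide_distrib sum_negf)
      \<comment> \<open>Branch points occur only at the ends of a cut, so y does not vanish inside
        and a zero of the quotient is a root of \<open>p\<close>.\<close>
      have y0: "Re (y (of_real x)) \<noteq> 0" if x: "x \<in> {a k<..<b k}" for x
      proof
        assume "Re (y (of_real x)) = 0"
        moreover have "Im (y (of_real x)) = 0"
          using upper_branch_cut_real[OF rc ub cut(1-3), of x k] x unfolding a_def b_def cut(4) by simp
        ultimately have "y (of_real x) = 0"
          by (simp add: complex_eq_iff)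
        then have "(\<Prod>j\<in>{1..2 * CARD('g) + 1}. x - e j) = 0"
          using upper_branch_square[OF rc ub, of x] by (metis of_real_eq_0_iff zero_power2)
        then obtain j where j: "j \<in> {1..2 * CARD('g) + 1}" "x = e j"
          by (auto simp del: prod.cl_ivl_Suc)
        show False
        proof (cases "j \<le> 2 * pos k - 1")
          case True
          then have "e j \<le> a k"
            unfolding a_def using j cut[of k] by (intro real_curve_le[OF rc]) auto
          then show False using x j by auto
        next
          case False
          then have "b k \<le> e j"
            unfolding b_def using j cut[of k] pos_range[of k] by (intro real_curve_le[OF rc]) auto
          then show False using x j by auto
        qed
      qed
      have conty: "continuous_on {z. Im z \<ge> 0} y"
        using ub by (simp add: upper_branch_def)
      have "continuous_on {a k<..<b k} (\<lambda>x. y (of_real x))"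
        by (rule continuous_on_compose2[OF conty]) (auto intro!: continuous_intros)
      then have "continuous_on {a k<..<b k} (\<lambda>x. poly p x / (- 2) / Re (y (of_real x)))"
        using y0 by (intro continuous_on_divide continuous_on_Re continuous_on_poly
            continuous_on_const continuous_on_id) auto
      moreover have "(\<lambda>x. \<Sum>n\<in>UNIV. c $ n * f n x) integrable_on {a k..b k}"
        by (intro integrable_sum integrable_on_mult_right fint) auto
      moreover have "integral {a k..b k} (\<lambda>x. \<Sum>n\<in>UNIV. c $ n * f n x) = 0"
      proof -
        have "integral {a k..b k} (\<lambda>x. \<Sum>n\<in>UNIV. c $ n * f n x) = (\<Sum>n\<in>UNIV. c $ n * integral {a k..b k} (f n))"
          by (subst integral_sum) (auto intro!: integrable_on_mult_right fint)
        also have "\<dots> = (\<Sum>n\<in>UNIV. transpose W $ k $ n * c $ n) / 2"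
          by (simp add: transpose_def Wf sum_divide_distrib mult_ac)
        also have "(\<Sum>n\<in>UNIV. transpose W $ k $ n * c $ n) = (transpose W *v c) $ k"
          by (simp only: matrix_vector_mult_def vec_lambda_beta)
        finally show ?thesis
          by (simp only: c zero_index div_0)
      qed
      ultimately obtain x where "x \<in> {a k<..<b k}" "poly p x / (- 2) / Re (y (of_real x)) = 0"
        unfolding Fp by (rule integral_zero_imp_root[OF ab])
      then show ?thesis
        using y0 by auto
    qed
    then obtain x where x: "\<And>k. x k \<in> {a k<..<b k}" "\<And>k. poly p (x k) = 0"
      by metis
    \<comment> \<open>The cuts follow one another in the order of \<open>pos\<close>, so roots taken
      from different cuts are distinct.\<close>
    have "x j < x k" if "pos j < pos k" for j k
    proof -
      have "b j \<le> a k"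
        unfolding a_def b_def using that pos_range[of j] pos_range[of k]
        by (intro real_curve_le[OF rc]) auto
      then show ?thesis
        using x(1)[of j] x(1)[of k] by auto
    qed
    then have "inj x"
      by (metis (full_types) injD injI linorder_neqE_nat order_less_irrefl pos_inj)
    then have card: "card (range x) = CARD('g)"
      by (simp add: card_image)
    have "p = 0"
    proof (rule ccontr)
      assume "p \<noteq> 0"
      then have "card (range x) \<le> card {x. poly p x = 0}"
        using x(2) by (intro card_mono poly_roots_finite) auto
      also have "\<dots> \<le> degree p"
        using \<open>p \<noteq> 0\<close> by (rule card_poly_roots_bound)
      also have "\<dots> \<le> CARD('g) - 1"
        unfolding p_def
      proof (intro degree_sum_le order_trans[OF degree_monom_le])
        fix n :: 'g
        show "CARD('g) - pos n \<le> CARD('g) - 1"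
          using pos_range[of n] by auto
      qed auto
      \<comment> \<open>The index type is nonempty, so g > 0 and the truncated difference g - 1 is
        really smaller than g.\<close>
      finally show False
        unfolding card using zero_less_card_finite[where 'a = 'g] by linarith
    qed
    have "c $ i = 0" for i
    proof -
      have "0 = poly.coeff p (CARD('g) - pos i)"
        by (simp add: \<open>p = 0\<close>)
      also have "\<dots> = (\<Sum>n\<in>UNIV. if n = i then c $ n else 0)"
        unfolding p_def coeff_sum
      proof (intro sum.cong refl)
        fix n :: 'g
        have "CARD('g) - pos n = CARD('g) - pos i \<longleftrightarrow> pos n = pos i"
          using pos_range[of n] pos_range[of i] by linarith
        then have "CARD('g) - pos n = CARD('g) - pos i \<longleftrightarrow> n = i"
          by (simp only: inj_eq[OF pos_inj])
        then show "poly.coeff (monom (c $ n) (CARD('g) - pos n)) (CARD('g) - pos i) = (if n = i then c $ n else 0)"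
          by auto
      qed
      finally show ?thesis by simp
    qed
    then show "c = 0"
      by (simp add: vec_eq_iff)
  qed
  then obtain N where "W ** N = mat 1"
    using matrix_left_invertible_ker[of "transpose W"] left_invertible_transpose[of W] by blast
  then have WN: "W ** N = mat 1" "N ** W = mat 1"
    by (simp_all add: matrix_left_right_inverse)
  then have "cmat N ** omega e y = mat 1" "omega e y ** cmat N = mat 1"
    by (simp_all add: W cmat_mat_1 flip: cmat_mult)
  then show ?thesis
    using matrix_inv_eqI by blast
qed

section \<open>Reflection in a real half-period\<close>

text \<open>Reflecting in the imaginary axis and conjugating afterwards gives a holomorphic function
  again; the sign comes from the inner minus.\<close>

lemma has_field_derivative_cnj_reflect:
  assumes "(g has_field_derivative D) (at (- cnj t))"
  shows "((\<lambda>t. cnj (g (- cnj t))) has_field_derivative - cnj D) (at t)"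
proof -
  have "((\<lambda>z. g (- z)) has_field_derivative D * (- 1)) (at (cnj t))"
    by (rule DERIV_chain2[where f = g]) (auto intro!: derivative_eq_intros assms)
  from has_field_derivative_cnj_cnj[OF this] show ?thesis
    by (simp add: o_def)
qed

text \<open>Differentiating both sides of the symmetry changes the sign of the factor. At t = 0 the
  factor 1 means a real value and -1 an imaginary one, so successive derivatives alternate.\<close>

lemma cnj_reflect_deriv:
  assumes m: "m holomorphic_on ball 0 r"
    and sym: "\<And>t. t \<in> ball 0 r \<Longrightarrow> cnj (m (- cnj t)) = c * m t" and t: "t \<in> ball 0 r"
  shows "cnj (deriv m (- cnj t)) = - c * deriv m t"
proof -
  have m': "(m has_field_derivative deriv m z) (at z)" if "z \<in> ball 0 r" for z
    using holomorphic_derivI[OF m] that by auto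
  have "- cnj t \<in> ball 0 r"
    using t by simp
  then have "((\<lambda>t. cnj (m (- cnj t))) has_field_derivative - cnj (deriv m (- cnj t))) (at t)"
    by (intro has_field_derivative_cnj_reflect m')
  then have "((\<lambda>t. c * m t) has_field_derivative - cnj (deriv m (- cnj t))) (at t)"
    by (rule has_field_derivative_transform_within_open[OF _ open_ball t sym])
  moreover have "((\<lambda>t. c * m t) has_field_derivative c * deriv m t) (at t)"
    using m'[OF t] by (rule DERIV_cmult)
  ultimately have "- cnj (deriv m (- cnj t)) = c * deriv m t"
    by (rule DERIV_unique)
  then show ?thesis
    by (metis minus_mult_left neg_equal_iff_equal minus_minus)
qed

lemma vcnj_cmat_mult: "vcnj (cmat N *v w) = cmat N *v vcnj w"
  by (simp add: vec_eq_iff matrix_vector_mult_def)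

text \<open>\<open>omega\<close> contributes only real parts and \<open>omega'\<close> only
  imaginary ones, so for a real vector the \<open>omega'\<close> part drops out. Doubling clears the
  factor 1/2.\<close>

lemma real_half_period:
  fixes u :: "real ^ 'g::{finite,linorder}"
  assumes "real_curve lam CARD('g) e" "upper_branch (curve_poly lam CARD('g)) y"
    and "half_period e y (cplx u 0)"
  obtains eps where "2 *s cplx u 0 = omega e y *v cvec eps"
proof -
  obtain eps eps' where h: "cplx u 0 = (1 / 2) *s (omega e y *v cvec eps) + (1 / 2) *s (omega' e y *v cvec eps')"
    using assms(3) by (auto simp: half_period_def)
  have "Im ((omega e y *v cvec eps) $ i) = 0" for i
    using omega_real[OF assms(1,2)] by (simp add: matrix_vector_mult_def Im_sum)
  moreover have "Re ((omega' e y *v cvec eps') $ i) = 0" for i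
    using omega'_imaginary[OF assms(1,2)] by (simp add: matrix_vector_mult_def Re_sum)
  moreover have "cplx u 0 $ i = (1 / 2) * (omega e y *v cvec eps) $ i + (1 / 2) * (omega' e y *v cvec eps') $ i" for i
    by (simp add: h)
  ultimately have "2 *s cplx u 0 = omega e y *v cvec eps"
    by (simp add: vec_eq_iff complex_eq_iff cplx_def mult.commute)
  then show thesis
    by (rule that)
qed

lemma dotp_matrix_add:
  "dotp (w + t *s d) (A *v (w + t *s d)) =
    dotp w (A *v w) + t * (dotp d (A *v w) + dotp w (A *v d)) + t\<^sup>2 * dotp d (A *v d)"
proof -
  have add: "dotp (a + b) c = dotp a c + dotp b c" for a b c :: "complex ^ 'a"
    by (simp add: dotp_def algebra_simps sum.distrib)
  have scale: "dotp (t *s a) b = t * dotp a b" "dotp a (t *s b) = t * dotp a b" for a b :: "complex ^ 'a"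
    by (simp_all add: dotp_def sum_distrib_left mult_ac)
  have "A *v (w + t *s d) = A *v w + t *s (A *v d)"
    by (simp add: vec.add vec.scale)
  then show ?thesis
    by (simp add: add scale dotp_add_right algebra_simps power2_eq_square)
qed

text \<open>The reflection of \<open>u + \<i> \<upsilon>\<close> in the real half-period \<open>u\<close>, followed by complex
  conjugation, fixes \<open>u + \<i> \<upsilon>\<close>. On the theta factor it acts as the identity.\<close>

lemma theta_reflect:
  assumes T: "\<And>i j. Re (T $ i $ j) = 0"
  shows "cnj (theta T (cvec eps - cmat N *v vcnj w + (1 / 2) *s cvec b + T *v ((1 / 2) *s cvec a))) =
    theta T (cmat N *v w + (1 / 2) *s cvec b + T *v ((1 / 2) *s cvec a))"
proof -
  have "vcnj (T *v ((1 / 2) *s cvec a)) = - (T *v ((1 / 2) *s cvec a))"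
    using T by (simp add: vec_eq_iff matrix_vector_mult_def complex_eq_iff Re_sum Im_sum sum_negf)
  moreover have "vcnj (vcnj w) = w" "vcnj (x + z) = vcnj x + vcnj z" "vcnj (x - z) = vcnj x - vcnj z"
    "vcnj (cvec m) = cvec m" "vcnj ((1 / 2) *s x) = (1 / 2) *s vcnj x" for x z :: "complex ^ 'a" and m :: "int ^ 'a"
    by (simp_all add: vec_eq_iff)
  ultimately have "cnj (theta T (cvec eps - cmat N *v vcnj w + (1 / 2) *s cvec b + T *v ((1 / 2) *s cvec a))) =
      theta T (cvec eps - cmat N *v w + (1 / 2) *s cvec b - T *v ((1 / 2) *s cvec a))"
    by (simp add: cnj_theta[OF T] vcnj_cmat_mult)
  also have "\<dots> = theta T (- (cvec eps - cmat N *v w + (1 / 2) *s cvec b - T *v ((1 / 2) *s cvec a)))"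
    by (rule theta_minus [symmetric])
  \<comment> \<open>The sign change turns b/2 into -b/2, which differs from b/2 by the integer
    vector b; the half-period contributes the integer vector \<open>eps\<close>.\<close>
  also have "- (cvec eps - cmat N *v w + (1 / 2) *s cvec b - T *v ((1 / 2) *s cvec a)) =
      cmat N *v w + (1 / 2) *s cvec b + T *v ((1 / 2) *s cvec a) + cvec (- eps - b)"
    by (simp add: vec_eq_iff algebra_simps)
  finally show ?thesis
    by (simp only: theta_add_cvec)
qed

text \<open>In \<open>log \<sigma>\<close> the Gaussian factor contributes a quadratic polynomial with real second
  derivatives, so only the logarithmic derivative of the theta factor \<open>P\<close> matters.\<close>

lemma wp_reflect:
  fixes P :: "complex ^ 'n \<Rightarrow> complex"
  assumes s: "\<And>w t i. s (w + t *s axis i 1) =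
      exp (A w + t * L i w + t\<^sup>2 * complex_of_real (q i)) * P (w + t *s axis i 1)"
    and L: "\<And>i j w t. L i (w + t *s axis j 1) = L i w + t * complex_of_real (k i j)"
    and P: "\<And>w i t. ((\<lambda>t. P (w + t *s axis i 1)) has_field_derivative P' i (w + t *s axis i 1)) (at t)"
    and P': "\<And>i w j. (\<lambda>t. P' i (w + t *s axis j 1)) holomorphic_on UNIV"
    and refl: "\<And>w. cnj (P (r - vcnj w)) = P w"
    and p: "r - vcnj p = p" "s p \<noteq> 0"
  shows "wp2 s j i p \<in> \<real>" "Re (wp3 s j j i p) = 0"
proof -
  have s0: "s w = exp (A w) * P w" for w
    using s[of w 0] by simp
  have dlog: "dlog i s w = L i w + P' i w / P w" if "P w \<noteq> 0" for i w
  proof -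
    have "((\<lambda>t. exp (A w + t * L i w + t\<^sup>2 * of_real (q i)) * P (w + t *s axis i 1)) has_field_derivative
        exp (A w) * L i w * P w + P' i w * exp (A w)) (at 0)"
      using P[of w i 0] by (auto intro!: derivative_eq_intros)
    then have "partial i s w = exp (A w) * L i w * P w + P' i w * exp (A w)"
      unfolding partial_def s by (rule DERIV_imp_deriv)
    then show ?thesis
      using that by (simp add: dlog_def s0 field_simps)
  qed
  \<comment> \<open>The reflection followed by conjugation sends a step t along an axis to -cnj t,
    so differentiating the invariance of \<open>P\<close> yields a minus sign.\<close>
  have refl': "cnj (P' i (r - vcnj w)) = - P' i w" for i w
  proof -
    have "r - vcnj (w + t *s axis i 1) = (r - vcnj w) + (- cnj t) *s axis i 1" for t
      by (simp add: vec_eq_iff axis_def)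
    then have eq: "cnj (P ((r - vcnj w) + (- cnj t) *s axis i 1)) = P (w + t *s axis i 1)" for t
      using refl[of "w + t *s axis i 1"] by (simp only:)
    have "((\<lambda>t. cnj (P ((r - vcnj w) + (- cnj t) *s axis i 1))) has_field_derivative
        - cnj (P' i ((r - vcnj w) + (- cnj 0) *s axis i 1))) (at 0)"
      by (intro has_field_derivative_cnj_reflect P)
    then have "((\<lambda>t. P (w + t *s axis i 1)) has_field_derivative - cnj (P' i (r - vcnj w))) (at 0)"
      unfolding eq by simp
    moreover have "((\<lambda>t. P (w + t *s axis i 1)) has_field_derivative P' i w) (at 0)"
      using P[of w i 0] by simp
    ultimately show ?thesis
      by (metis DERIV_unique minus_minus)
  qed
  \<comment> \<open>\<open>m\<close> is the logarithmic derivative of \<open>P\<close> in direction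
    i, restricted to the line through \<open>p\<close> in direction j; \<open>h\<close> is the same
    for \<open>s\<close>.\<close>
  define m where "m t = P' i (p + t *s axis j 1) / P (p + t *s axis j 1)" for t
  define h where "h t = dlog i s (p + t *s axis j 1)" for t
  have hol: "(\<lambda>t. P (p + t *s axis j 1)) holomorphic_on UNIV"
    using P by (auto simp: holomorphic_on_open)
  have "P p \<noteq> 0"
    using p(2) by (simp add: s0)
  moreover have "((\<lambda>t. P (p + t *s axis j 1)) \<longlongrightarrow> P p) (at 0)"
    using DERIV_isCont[OF P[of p j 0]] by (simp add: isCont_def)
  ultimately have "\<forall>\<^sub>F t in nhds 0. P (p + t *s axis j 1) \<noteq> 0"
    by (auto simp: eventually_nhds_conv_at intro: tendsto_imp_eventually_ne)
  \<comment> \<open>On this disc \<open>P\<close> has no zeros, so \<open>m\<close> is holomorphic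
    there and may be differentiated twice.\<close>
  then obtain \<rho> where \<rho>: "\<rho> > 0" "\<And>t. t \<in> ball 0 \<rho> \<Longrightarrow> P (p + t *s axis j 1) \<noteq> 0"
    unfolding eventually_nhds_metric by (auto simp: dist_commute)
  have m_hol: "m holomorphic_on ball 0 \<rho>"
    unfolding m_def using \<rho>(2) hol P'[of i p j] holomorphic_on_subset
    by (intro holomorphic_on_divide) blast+
  \<comment> \<open>As \<open>p\<close> is fixed, the reflection acts on the line by t -> -cnj t.
    The numerator of \<open>m\<close> changes sign under the symmetry and the denominator does
    not.\<close>
  have m_sym: "cnj (m (- cnj t)) = (- 1) * m t" for t
  proof -
    have "r - vcnj (p + t *s axis j 1) = p + (- cnj t) *s axis j 1"
      using p(1) by (simp add: vec_eq_iff axis_def algebra_simps)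
    then show ?thesis
      unfolding m_def using refl[of "p + t *s axis j 1"] refl'[of i "p + t *s axis j 1"] by simp
  qed
  have m'_sym: "cnj (deriv m (- cnj t)) = 1 * deriv m t" if "t \<in> ball 0 \<rho>" for t
    using cnj_reflect_deriv[OF m_hol m_sym that] by simp
  have m''_sym: "cnj (deriv (deriv m) (- cnj t)) = - 1 * deriv (deriv m) t" if "t \<in> ball 0 \<rho>" for t
    by (rule cnj_reflect_deriv[OF holomorphic_deriv[OF m_hol open_ball] m'_sym that])
  have h: "h t = L i p + t * of_real (k i j) + m t" if "t \<in> ball 0 \<rho>" for t
    unfolding h_def m_def using dlog[OF \<rho>(2)[OF that]] L by simp
  have h_deriv: "deriv h t = of_real (k i j) + deriv m t" if t: "t \<in> ball 0 \<rho>" for t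
  proof -
    have "((\<lambda>t. L i p + t * of_real (k i j) + m t) has_field_derivative of_real (k i j) + deriv m t) (at t)"
      using holomorphic_derivI[OF m_hol open_ball t] by (auto intro!: derivative_eq_intros)
    then have "(h has_field_derivative of_real (k i j) + deriv m t) (at t)"
      by (rule has_field_derivative_transform_within_open[OF _ open_ball t]) (simp add: h)
    then show ?thesis
      by (rule DERIV_imp_deriv)
  qed
  \<comment> \<open>The identity is needed along the whole line, not only at \<open>p\<close>,
    because \<open>wp3\<close> differentiates it once more in direction j.\<close>
  have part: "partial j (dlog i s) (p + t *s axis j 1) = deriv h t" for t
  proof -
    have "(\<lambda>x. dlog i s (p + t *s axis j 1 + x *s axis j 1)) = (\<lambda>x. h (t + x))"
      by (simp add: h_def vec.scale_left_distrib add.assoc)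
    then show ?thesis
      using deriv_shift_0[of h t] by (simp add: partial_def o_def)
  qed
  have zero: "(0::complex) \<in> ball 0 \<rho>"
    using \<rho> by simp
  have "wp2 s j i p = - (of_real (k i j) + deriv m 0)"
    using part[of 0] h_deriv[OF zero] by (simp add: wp2_def)
  moreover have "deriv m 0 \<in> \<real>"
    using m'_sym[OF zero] by (simp add: Reals_cnj_iff)
  ultimately show "wp2 s j i p \<in> \<real>"
    by simp
  have "((\<lambda>t. of_real (k i j) + deriv m t) has_field_derivative deriv (deriv m) 0) (at 0)"
    using holomorphic_derivI[OF holomorphic_deriv[OF m_hol open_ball] open_ball zero]
    by (auto intro!: derivative_eq_intros)
  then have "((\<lambda>t. partial j (dlog i s) (p + t *s axis j 1)) has_field_derivative deriv (deriv m) 0) (at 0)"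
    by (rule has_field_derivative_transform_within_open[OF _ open_ball zero]) (simp add: part h_deriv)
  then have "wp3 s j j i p = - deriv (deriv m) 0"
    unfolding wp3_def partial_def[of j "partial j (dlog i s)"] by (simp add: DERIV_imp_deriv)
  moreover have "Re (deriv (deriv m) 0) = 0"
    using m''_sym[OF zero] by (simp add: complex_eq_iff)
  ultimately show "Re (wp3 s j j i p) = 0"
    by simp
qed

theorem proposition5:
  fixes lam :: "nat \<Rightarrow> complex" and e :: "nat \<Rightarrow> real" and y :: "complex \<Rightarrow> complex"
    and C :: complex and u :: "real ^ 'g::{finite,linorder}"
    and s :: "complex ^ 'g::{finite,linorder} \<Rightarrow> complex" and one :: 'g
  defines "s \<equiv> sigma_fun lam e y C" and "one \<equiv> Min UNIV"
  assumes "real_curve lam CARD('g) e"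
    and "upper_branch (curve_poly lam CARD('g)) y"
    and "C \<noteq> 0"
    and "half_period e y (cplx u 0)"
  shows "\<forall>v. s (cplx u v) \<noteq> 0 \<longrightarrow>
           (\<forall>i. wp2 s one i (cplx u v) \<in> \<real>) \<and>
           (\<forall>i. Re (wp3 s one one i (cplx u v)) = 0)"
proof (intro allI impI)
  fix v assume nz: "s (cplx u v) \<noteq> 0"
  note rc = assms(3) and ub = assms(4)
  obtain N :: "real ^ 'g::{finite,linorder} ^ 'g::{finite,linorder}"
    where N: "matrix_inv (omega e y) = cmat N" "cmat N ** omega e y = mat 1"
    using omega_invertible[OF rc ub] by blast
  obtain eps where eps: "2 *s cplx u 0 = omega e y *v cvec eps"
    using real_half_period[OF rc ub assms(6)] .
  define T K :: "complex ^ 'g::{finite,linorder} ^ 'g::{finite,linorder}"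
    where "T = tau e y" and "K = kappa lam e y"
  have T: "Re (T $ i $ j) = 0" for i j
    using omega'_imaginary[OF rc ub] by (simp add: T_def tau_def N matrix_matrix_mult_def Re_sum)
  have K: "Im (K $ i $ j) = 0" for i j
    using eta_real[OF rc ub] by (simp add: K_def kappa_def N matrix_matrix_mult_def Im_sum)
  define a b :: "complex ^ 'g::{finite,linorder}"
    where "a = (1 / 2) *s cvec riemann_eps'" and "b = (1 / 2) *s cvec riemann_eps"
  define P where "P w = theta T (cmat N *v w + b + T *v a)" for w
  \<comment> \<open>The constant C enters the exponent as \<open>Ln C\<close>, so that sigma is a
    pure exponential times \<open>P\<close>.\<close>
  define A where "A w = Ln C + (- (1 / 2) * dotp w (K *v w)) +
      (\<i> * of_real pi * dotp a (T *v a) + 2 * \<i> * of_real pi * dotp (cmat N *v w + b) a)" for w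
  have s: "s w = exp (A w) * P w" for w
    by (simp only: s_def sigma_fun_def theta_char_def Let_def A_def P_def K_def T_def N a_def b_def
        exp_add exp_Ln[OF \<open>C \<noteq> 0\<close>] mult.assoc)
  define c where "c = theta_coeff T"
  have "theta T (cmat N *v cplx u v + b + T *v a) \<noteq> 0"
    using nz by (simp add: s P_def)
  \<comment> \<open>A point where sigma does not vanish guarantees that the theta series converges
    everywhere, together with its derivatives.\<close>
  then have c: "rapidly_decaying c"
    unfolding c_def by (rule theta_nonzero_imp_rapidly_decaying[OF T])
  \<comment> \<open>Coordinate lines for w become lines in direction \<open>d i\<close> for the
    argument of theta, as \<open>line\<close> records.\<close>
  define d where "d i = cmat N *v axis i 1" for i
  define P' where "P' i w = fourier_series (diff_coeff (d i) c) (cmat N *v w + b + T *v a)" for i w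
  have line: "cmat N *v (w + t *s axis i 1) + b + T *v a = (cmat N *v w + b + T *v a) + t *s d i" for w t i
    by (simp add: d_def vec.add vec.scale)
  define L where "L i w = - 1 / 2 * (dotp (axis i 1) (K *v w) + dotp w (K *v axis i 1)) +
      2 * \<i> * of_real pi * dotp (d i) a" for i w
  \<comment> \<open>The second partial derivatives of the exponent: minus the symmetrized entries of
    \<open>K\<close>, which are real.\<close>
  define k where "k i j = - 1 / 2 * Re (K $ i $ j + K $ j $ i)" for i j
  have axis: "dotp (axis i 1) x = x $ i" "dotp x (axis i 1) = x $ i" "(K *v axis i 1) $ j = K $ j $ i" for x i j
    by (simp_all add: dotp_def axis_def matrix_vector_mult_def if_distrib if_distribR cong: if_cong)
  show "(\<forall>i. wp2 s one i (cplx u v) \<in> \<real>) \<and> (\<forall>i. Re (wp3 s one one i (cplx u v)) = 0)"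
  proof (intro conjI allI)
    fix i
    have A: "A (w + t *s axis i 1) = A w + t * L i w + t\<^sup>2 * of_real (- 1 / 2 * Re (K $ i $ i))" for w t i
    proof -
      have lin: "dotp (cmat N *v (w + t *s axis i 1) + b) a = dotp (cmat N *v w + b) a + t * dotp (d i) a"
        by (simp add: d_def vec.add vec.scale dotp_def algebra_simps sum.distrib sum_distrib_left)
      have diag: "of_real (- 1 / 2 * Re (K $ i $ i)) = - 1 / 2 * K $ i $ i"
        using K by (simp add: complex_eq_iff)
      show ?thesis
        unfolding A_def L_def lin dotp_matrix_add axis diag by (simp add: field_simps)
    qed
    have s_line: "s (w + t *s axis i 1) = exp (A w + t * L i w + t\<^sup>2 * of_real (- 1 / 2 * Re (K $ i $ i))) * P (w + t *s axis i 1)" for w t i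
      by (simp only: s A)
    have L: "L i (w + t *s axis j 1) = L i w + t * of_real (k i j)" for i j w t
    proof -
      have k: "of_real (k i j) = - 1 / 2 * (K $ i $ j + K $ j $ i)"
        using K by (simp add: k_def complex_eq_iff)
      have K1: "(K *v (w + t *s axis j 1)) $ i = (K *v w) $ i + t * K $ i $ j"
        by (simp add: vec.add vec.scale axis)
      have K2: "dotp (w + t *s axis j 1) (K *v axis i 1) = dotp w (K *v axis i 1) + t * K $ j $ i"
        by (simp add: dotp_def axis algebra_simps sum.distrib sum_distrib_left)
           (simp add: axis_def if_distrib if_distribR cong: if_cong)
      show ?thesis
        unfolding L_def axis(1) K1 K2 k by (simp add: algebra_simps)
    qed
    have P_deriv: "((\<lambda>t. P (w + t *s axis i 1)) has_field_derivative P' i (w + t *s axis i 1)) (at t)" for w i t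
      unfolding P_def P'_def line theta_eq_fourier_series c_def [symmetric]
      by (rule fourier_series_has_field_derivative[OF c])
    have P'_hol: "(\<lambda>t. P' i (w + t *s axis j 1)) holomorphic_on UNIV" for i w j
      unfolding P'_def line
      using fourier_series_has_field_derivative[OF rapidly_decaying_diff_coeff[OF c]]
      by (simp only: holomorphic_on_open[OF open_UNIV]) blast
    \<comment> \<open>In normalized coordinates the translation by 2u is a translation by an integer
      vector, which theta does not see.\<close>
    have Nu: "cmat N *v (2 *s cplx u 0) = cvec eps"
      unfolding eps matrix_vector_mul_assoc N by (rule matrix_vector_mul_lid)
    have refl: "cnj (P (2 *s cplx u 0 - vcnj w)) = P w" for w
      unfolding P_def vec.diff Nu a_def b_def by (rule theta_reflect[OF T])
    have fixed: "2 *s cplx u 0 - vcnj (cplx u v) = cplx u v"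
      by (simp add: vec_eq_iff cplx_def complex_eq_iff)
    show "wp2 s one i (cplx u v) \<in> \<real>" "Re (wp3 s one one i (cplx u v)) = 0"
      using wp_reflect[OF s_line L P_deriv P'_hol refl fixed nz] by blast+
  qed
qed

end
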